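(* Let $G=(V,E)$ be a locally finite graph. Let $x,y\in V$ with $x\sim y$. Then the function $p\mapsto \kappa_p(x,y)$ is concave and piecewise linear over $[0,1]$ with at most $3$ linear parts. Furthermore, $\kappa_p(x,y)$ is linear (as a function of $p$) on the intervals $$\left[0,\frac{1}{\operatorname{lcm}(d_x,d_y)+1}\right]\quad\text{and}\quad\left[\frac{1}{\max(d_x,d_y)+1},1\right].$$ Thus, if in addition $d_x=d_y$, then $p\mapsto\kappa_p(x,y)$ has at most two linear parts.
   Context: Graphs have no multiple edges or self loops (and are undirected). $x\sim y$ means that $x$ and $y$ are joined by an edge; $d_x$ is the degree of $x$; $d(x,y)$ is the combinatorial (shortest path) distance, with $d(x,y)=\infty$ if there is no path. For $x\in V$ with $d_x\ge 1$ and $p\in[0,1]$, $\mu_x^p$ is the probability measure on $V$ with $\mu_x^p(x)=p$, $\mu_x^p(z)=\frac{1-p}{d_x}$ for $z\sim x$, and $\mu_x^p(z)=0$ otherwise. For probability measures $\mu_1,\mu_2$ on $V$, the Wasserstein distance is $W_1(\mu_1,\mu_2)=\inf_{\pi}\sum_{u\in V}\sum_{v\in V}d(u,v)\pi(u,v)$, the infimum being over all $\pi:V\times V\to[0,1]$ with $\sum_{v}\pi(u,v)=\mu_1(u)$ for all $u$ and $\sum_{u}\pi(u,v)=\mu_2(v)$ for all $v$ (convention $\infty\cdot 0=0$). For an edge $x\sim y$ the $p$-Ollivier-Ricci curvature is $\kappa_p(x,y)=1-W_1(\mu_x^p,\mu_y^p)$. "Linear" means affine, i.e. of the form $p\mapsto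 ap+b$; "piecewise linear over $[0,1]$ with at most $k$ linear parts" means that $[0,1]$ can be subdivided into at most $k$ closed intervals on each of which the function is affine. *)

theory Defs
  imports "HOL-Analysis.Analysis"
begin

text \<open>A simple undirected graph is given by its vertex set and its adjacency relation. Neither
  finiteness nor connectedness is assumed, and isolated vertices are allowed.\<close>

locale simple_graph =
  fixes V :: "'a set" and E :: "'a \<Rightarrow> 'a \<Rightarrow> bool"
  assumes adj_in_V: "E u v \<Longrightarrow> u \<in> V \<and> v \<in> V"
    and adj_sym: "E u v \<Longrightarrow> E v u"
    and no_loops: "\<not> E v v"

locale locally_finite_graph = simple_graph +
  assumes locally_finite: "v \<in> V \<Longrightarrow> finite {w. E v w}"

definition vertex_degree :: "('a \<Rightarrow> 'a \<Rightarrow> bool) \<Rightarrow> 'a \<Rightarrow> nat" where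
  "vertex_degree E x = card {z. E x z}"

text \<open>\<open>(E ^^ n) u v\<close> says that there is a walk with \<open>n\<close> edges from \<open>u\<close> to \<open>v\<close>. The infimum over
  the empty set is \<open>\<infinity>\<close>.\<close>

definition graph_dist :: "('a \<Rightarrow> 'a \<Rightarrow> bool) \<Rightarrow> 'a \<Rightarrow> 'a \<Rightarrow> enat" where
  "graph_dist E u v = (INF n \<in> {n. (E ^^ n) u v}. enat n)"

text \<open>Probability measures on \<open>V\<close> are represented by their mass functions.\<close>

definition walk_measure :: "('a \<Rightarrow> 'a \<Rightarrow> bool) \<Rightarrow> real \<Rightarrow> 'a \<Rightarrow> 'a \<Rightarrow> real" where
  "walk_measure E p x z =
     (if z = x then p else if E x z then (1 - p) / real (vertex_degree E x) else 0)"

definition couplings :: "'a set \<Rightarrow> ('a \<Rightarrow> real) \<Rightarrow> ('a \<Rightarrow> real) \<Rightarrow> ('a \<Rightarrow> 'a \<Rightarrow> real) set" where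
  "couplings V \<mu>\<^sub>1 \<mu>\<^sub>2 = {\<pi>.
     (\<forall>u\<in>V. \<forall>v\<in>V. \<pi> u v \<in> {0..1}) \<and>
     (\<forall>u\<in>V. ((\<lambda>v. \<pi> u v) has_sum \<mu>\<^sub>1 u) V) \<and>
     (\<forall>v\<in>V. ((\<lambda>u. \<pi> u v) has_sum \<mu>\<^sub>2 v) V)}"

text \<open>In \<^typ>\<open>ennreal\<close> every family is summable, so the cost of a coupling is always its true value
  in \<open>[0, \<infinity>]\<close>; moreover \<open>\<infinity> * 0 = 0\<close> there.\<close>

definition wasserstein ::
  "'a set \<Rightarrow> ('a \<Rightarrow> 'a \<Rightarrow> bool) \<Rightarrow> ('a \<Rightarrow> real) \<Rightarrow> ('a \<Rightarrow> real) \<Rightarrow> ennreal" where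
  "wasserstein V E \<mu>\<^sub>1 \<mu>\<^sub>2 =
     (INF \<pi> \<in> couplings V \<mu>\<^sub>1 \<mu>\<^sub>2.
        \<Sum>\<^sub>\<infinity>u\<in>V. \<Sum>\<^sub>\<infinity>v\<in>V. ennreal_of_enat (graph_dist E u v) * ennreal (\<pi> u v))"

text \<open>The conversion \<^const>\<open>enn2real\<close> sends \<open>\<infinity>\<close> to \<open>0\<close>, but the Wasserstein distance is finite
  whenever \<open>x\<close> and \<open>y\<close> are adjacent and \<open>p \<in> [0, 1]\<close>; see \<open>wasserstein_walk_measure_finite\<close> below.\<close>

definition ollivier_curvature ::
  "'a set \<Rightarrow> ('a \<Rightarrow> 'a \<Rightarrow> bool) \<Rightarrow> real \<Rightarrow> 'a \<Rightarrow> 'a \<Rightarrow> real" where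
  "ollivier_curvature V E p x y =
     1 - enn2real (wasserstein V E (walk_measure E p x) (walk_measure E p y))"

definition affine_fun_on :: "real set \<Rightarrow> (real \<Rightarrow> real) \<Rightarrow> bool" where
  "affine_fun_on S f \<longleftrightarrow> (\<exists>a b. \<forall>p\<in>S. f p = a * p + b)"

definition piecewise_linear_on :: "nat \<Rightarrow> real \<Rightarrow> real \<Rightarrow> (real \<Rightarrow> real) \<Rightarrow> bool" where
  "piecewise_linear_on k a b f \<longleftrightarrow>
     (\<exists>n t. n \<le> k \<and> t 0 = a \<and> t n = b \<and>
        (\<forall>i<n. t i < t (Suc i) \<and> affine_fun_on {t i..t (Suc i)} f))"

context locally_finite_graph
begin

lemma walk_measure_nonneg: "p \<in> {0..1} \<Longrightarrow> 0 \<le> walk_measure E p x z"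
  by (simp add: walk_measure_def)

lemma walk_measure_has_sum:
  assumes "E x y"
  shows "(walk_measure E p x has_sum 1) V"
proof -
  let ?N = "{z. E x z}"
  have fin: "finite ?N" using assms adj_in_V locally_finite by blast
  have "?N \<noteq> {}" using assms by blast
  hence pos: "vertex_degree E x > 0" using fin by (simp add: vertex_degree_def card_gt_0_iff)
  have "sum (walk_measure E p x) (insert x ?N) = p + sum (walk_measure E p x) ?N"
    using fin no_loops by (simp add: walk_measure_def)
  also have "sum (walk_measure E p x) ?N = (\<Sum>z\<in>?N. (1 - p) / real (vertex_degree E x))"
    by (rule sum.cong) (use no_loops in \<open>auto simp: walk_measure_def\<close>)
  also have "\<dots> = 1 - p" using pos by (simp add: vertex_degree_def)
  finally have "sum (walk_measure E p x) (insert x ?N) = 1" by simp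
  moreover have "(walk_measure E p x has_sum sum (walk_measure E p x) (insert x ?N)) (insert x ?N)"
    using fin by (intro has_sum_finite) auto
  ultimately have *: "(walk_measure E p x has_sum 1) (insert x ?N)" by simp
  have "insert x ?N \<subseteq> V" using assms adj_in_V by blast
  hence "(walk_measure E p x has_sum 1) (insert x ?N)
      \<longleftrightarrow> (walk_measure E p x has_sum 1) V"
    by - (rule has_sum_cong_neutral, auto simp: walk_measure_def)
  with * show ?thesis by simp
qed

lemma walk_measure_le_1:
  assumes "E x y" "p \<in> {0..1}"
  shows "walk_measure E p x z \<le> 1"
proof -
  have "finite {z. E x z}" "{z. E x z} \<noteq> {}" using assms adj_in_V locally_finite by blast+
  hence "vertex_degree E x > 0" by (simp add: vertex_degree_def card_gt_0_iff)
  thus ?thesis using assms by (auto simp: walk_measure_def divide_simps)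
qed

lemma wasserstein_walk_measure_finite:
  assumes xy: "E x y" and p: "p \<in> {0..1}"
  shows "wasserstein V E (walk_measure E p x) (walk_measure E p y) < \<infinity>"
proof -
  define \<pi> where "\<pi> u v = walk_measure E p x u * walk_measure E p y v" for u v
  let ?c = "\<lambda>u v. ennreal_of_enat (graph_dist E u v) * ennreal (\<pi> u v)"
  define S where "S = insert x {z. E x z}"
  define T where "T = insert y {z. E y z}"
  have yx: "E y x" using xy adj_sym by blast
  have fin: "finite S" "finite T" and sub: "S \<subseteq> V" "T \<subseteq> V"
    using xy adj_in_V locally_finite unfolding S_def T_def by blast+
  have S0: "walk_measure E p x u = 0" if "u \<notin> S" for u
    using that by (auto simp: S_def walk_measure_def)
  have T0: "walk_measure E p y v = 0" if "v \<notin> T" for v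
    using that by (auto simp: T_def walk_measure_def)
  have "\<pi> \<in> couplings V (walk_measure E p x) (walk_measure E p y)"
    unfolding couplings_def mem_Collect_eq
  proof (intro conjI ballI)
    fix u v
    show "\<pi> u v \<in> {0..1}"
      unfolding \<pi>_def atLeastAtMost_iff
      by (intro conjI mult_nonneg_nonneg mult_le_one walk_measure_nonneg p
          walk_measure_le_1[OF xy p] walk_measure_le_1[OF yx p])
  next
    fix u
    show "((\<lambda>v. \<pi> u v) has_sum walk_measure E p x u) V"
      using has_sum_cmult_right[OF walk_measure_has_sum[OF yx, of p], of "walk_measure E p x u"]
      by (simp add: \<pi>_def)
  next
    fix v
    show "((\<lambda>u. \<pi> u v) has_sum walk_measure E p y v) V"
      using has_sum_cmult_left[OF walk_measure_has_sum[OF xy, of p], of "walk_measure E p y v"]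
      by (simp add: \<pi>_def)
  qed
  hence "wasserstein V E (walk_measure E p x) (walk_measure E p y)
           \<le> (\<Sum>\<^sub>\<infinity>u\<in>V. \<Sum>\<^sub>\<infinity>v\<in>V. ?c u v)"
    unfolding wasserstein_def by (rule INF_lower)
  also have "\<dots> = (\<Sum>\<^sub>\<infinity>u\<in>S. \<Sum>\<^sub>\<infinity>v\<in>T. ?c u v)"
  proof (rule infsum_cong_neutral)
    fix u assume "u \<in> V - S"
    thus "(\<Sum>\<^sub>\<infinity>v\<in>V. ?c u v) = 0" by (simp add: \<pi>_def S0)
  next
    fix u assume "u \<in> V \<inter> S"
    show "(\<Sum>\<^sub>\<infinity>v\<in>V. ?c u v) = (\<Sum>\<^sub>\<infinity>v\<in>T. ?c u v)"
      by (rule infsum_cong_neutral) (use sub in \<open>auto simp: \<pi>_def T0\<close>)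
  qed (use sub in auto)
  also have "\<dots> = (\<Sum>u\<in>S. \<Sum>v\<in>T. ?c u v)" using fin by simp
  also have "\<dots> < \<infinity>"
  proof -
    have "graph_dist E u v \<noteq> \<infinity>" if "u \<in> S" "v \<in> T" for u v
    proof -
      have "E\<^sup>*\<^sup>* u x" using that(1) adj_sym by (auto simp: S_def)
      moreover have "E\<^sup>*\<^sup>* x y" using xy by blast
      moreover have "E\<^sup>*\<^sup>* y v" using that(2) by (auto simp: T_def)
      ultimately have "E\<^sup>*\<^sup>* u v" by (meson rtranclp_trans)
      then obtain n where "(E ^^ n) u v" by (metis rtranclp_imp_relpowp)
      hence "graph_dist E u v \<le> enat n" unfolding graph_dist_def by (auto intro: INF_lower)
      thus ?thesis by (cases "graph_dist E u v") auto
    qed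
    hence "ennreal_of_enat (graph_dist E u v) < \<infinity>" if "u \<in> S" "v \<in> T" for u v
      using that by (cases "graph_dist E u v") (blast | simp add: of_nat_less_top)+
    thus ?thesis using fin by (auto simp: ennreal_mult_less_top)
  qed
  finally show ?thesis .
qed

end

end

theory Submission
  imports Defs
begin

text \<open>By Kantorovich duality with an integer-valued metric, the Wasserstein distance at idleness \<open>p\<close> is the
  maximum of \<open>p * (f x - f y) + (1 - p) * A f\<close> over integer-valued 1-Lipschitz potentials \<open>f\<close> on the
  union of the two unit balls, where \<open>A f\<close> is the difference of the means of \<open>f\<close> over the neighbours of \<open>x\<close>
  and of \<open>y\<close>. Since \<open>f x - f y\<close> only takes the values \<open>-1, 0, 1\<close>, this is a maximum of three lines
  \<open>p * j + (1 - p) * c\<^sub>j\<close>. The numbers \<open>c\<^sub>j\<close> are multiples of \<open>1 / lcm d\<^sub>x d\<^sub>y\<close>, which bounds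
  the positive break points from below. Rounding the midpoint of two potentials gives
  \<open>c\<^sub>1 + c\<^bsub>-1\<^esub> \<le> 2 c\<^sub>0\<close>, and a potential with \<open>f x = f y\<close> can be modified into one with
  \<open>f x - f y = 1\<close> at a cost of at most \<open>1 / max d\<^sub>x d\<^sub>y\<close>, which bounds them from above.\<close>

subsection \<open>Integral Kantorovich duality\<close>

text \<open>The Halmos--Vaughan induction for the marriage theorem, with real weights: ship as much as Hall's
  condition permits along one edge. This empties a supply or a demand, or makes a proper subset
  tight, and the problem then splits.\<close>

lemma fractional_hall:
  fixes s :: "'a \<Rightarrow> real" and t :: "'b \<Rightarrow> real"
  assumes "finite A" "finite B"
    and "\<And>a. a \<in> A \<Longrightarrow> 0 \<le> s a" "\<And>b. b \<in> B \<Longrightarrow> 0 \<le> t b"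
    and "\<And>S. S \<subseteq> A \<Longrightarrow> sum s S \<le> sum t (R `` S \<inter> B)"
  shows "\<exists>\<pi>. (\<forall>a b. 0 \<le> \<pi> a b) \<and> (\<forall>a b. (a, b) \<notin> R \<inter> A \<times> B \<longrightarrow> \<pi> a b = 0) \<and>
    (\<forall>a\<in>A. (\<Sum>b\<in>B. \<pi> a b) = s a) \<and> (\<forall>b\<in>B. (\<Sum>a\<in>A. \<pi> a b) \<le> t b)"
  using assms
proof (induction "card A + card B" arbitrary: A B s t rule: less_induct)
  case less
  note fin = \<open>finite A\<close> \<open>finite B\<close> and s0 = less.prems(3) and t0 = less.prems(4)
    and hall = less.prems(5)
  show ?case
  proof (cases "R \<inter> A \<times> B = {}")
    case True
    have "s a = 0" if "a \<in> A" for a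
    proof -
      have "R `` {a} \<inter> B = {}" using True that by blast
      thus ?thesis using hall[of "{a}"] s0[OF that] that by simp
    qed
    thus ?thesis using t0 by (intro exI[of _ "\<lambda>_ _. 0"]) auto
  next
    case False
    then obtain a b where ab: "(a, b) \<in> R" "a \<in> A" "b \<in> B" by blast
    \<comment> \<open>Shipping \<epsilon> from \<open>a\<close> to \<open>b\<close> reduces the Hall
      slack exactly of the sets in \<open>F\<close>: a set containing \<open>a\<close> loses
      \<epsilon> on both sides, one whose image misses \<open>b\<close> on neither.\<close>
    define F where "F = {S. S \<subseteq> A - {a} \<and> b \<in> R `` S}"
    define G where "G = insert (s a) (insert (t b) ((\<lambda>S. sum t (R `` S \<inter> B) - sum s S) ` F))"
    define \<epsilon> where "\<epsilon> = Min G"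
    have "finite F" by (rule finite_subset[of _ "Pow A"]) (use fin in \<open>auto simp: F_def\<close>)
    hence finG: "finite G" "G \<noteq> {}" by (auto simp: G_def)
    have \<epsilon>G: "\<epsilon> \<in> G" unfolding \<epsilon>_def by (rule Min_in[OF finG])
    have \<epsilon>le: "\<epsilon> \<le> g" if "g \<in> G" for g unfolding \<epsilon>_def by (rule Min_le[OF finG(1) that])
    have \<epsilon>0: "0 \<le> \<epsilon>" 
    proof -
      have "sum s S \<le> sum t (R `` S \<inter> B)" if "S \<in> F" for S
        using that by (intro hall) (auto simp: F_def)
      thus ?thesis using \<epsilon>G s0[OF ab(2)] t0[OF ab(3)] unfolding G_def by auto
    qed
    define s' where "s' = s(a := s a - \<epsilon>)"
    define t' where "t' = t(b := t b - \<epsilon>)"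
    have s'0: "0 \<le> s' u" if "u \<in> A" for u using s0[OF that] \<epsilon>le[of "s a"] by (auto simp: s'_def G_def)
    have t'0: "0 \<le> t' u" if "u \<in> B" for u using t0[OF that] \<epsilon>le[of "t b"] by (auto simp: t'_def G_def)
    have sum_s': "sum s' S = sum s S - (if a \<in> S then \<epsilon> else 0)" if "S \<subseteq> A" for S
    proof -
      have "finite S" using that fin by (metis finite_subset)
      moreover have "s' u = s u - (if u = a then \<epsilon> else 0)" for u by (simp add: s'_def)
      ultimately show ?thesis by (simp add: sum_subtractf)
    qed
    have sum_t': "sum t' S = sum t S - (if b \<in> S then \<epsilon> else 0)" if "S \<subseteq> B" for S
    proof -
      have "finite S" using that fin by (metis finite_subset)
      moreover have "t' u = t u - (if u = b then \<epsilon> else 0)" for u by (simp add: t'_def)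
      ultimately show ?thesis by (simp add: sum_subtractf)
    qed
    have hall': "sum s' S \<le> sum t' (R `` S \<inter> B)" if S: "S \<subseteq> A" for S
    proof (cases "a \<in> S \<or> b \<notin> R `` S")
      case True
      moreover have "b \<in> R `` S" if "a \<in> S" using that ab by blast
      ultimately show ?thesis using hall[OF S] \<epsilon>0 ab by (auto simp: sum_s'[OF S] sum_t')
    next
      case False
      hence "S \<in> F" using S by (auto simp: F_def)
      hence "\<epsilon> \<le> sum t (R `` S \<inter> B) - sum s S" by (intro \<epsilon>le) (auto simp: G_def)
      thus ?thesis using False ab by (auto simp: sum_s'[OF S] sum_t')
    qed
    have "\<exists>\<pi>. (\<forall>a b. 0 \<le> \<pi> a b) \<and> (\<forall>a b. (a, b) \<notin> R \<inter> A \<times> B \<longrightarrow> \<pi> a b = 0) \<and>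
      (\<forall>a\<in>A. (\<Sum>b\<in>B. \<pi> a b) = s' a) \<and> (\<forall>b\<in>B. (\<Sum>a\<in>A. \<pi> a b) \<le> t' b)"
    proof -
      consider "\<epsilon> = s a" | "\<epsilon> = t b" | S where "S \<in> F" "\<epsilon> = sum t (R `` S \<inter> B) - sum s S"
        using \<epsilon>G by (auto simp: G_def)
      thus ?thesis
      proof cases
        case 1
        have "\<exists>\<pi>. (\<forall>a b. 0 \<le> \<pi> a b) \<and> (\<forall>u v. (u, v) \<notin> R \<inter> (A - {a}) \<times> B \<longrightarrow> \<pi> u v = 0) \<and>
          (\<forall>u\<in>A-{a}. (\<Sum>b\<in>B. \<pi> u b) = s' u) \<and> (\<forall>b\<in>B. (\<Sum>u\<in>A-{a}. \<pi> u b) \<le> t' b)"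
        proof (rule less.hyps)
          show "card (A - {a}) + card B < card A + card B"
            using card_Diff1_less[OF fin(1) ab(2)] by linarith
        next
          fix S assume "S \<subseteq> A - {a}"
          thus "sum s' S \<le> sum t' (R `` S \<inter> B)" by (intro hall') auto
        qed (use fin s'0 t'0 in auto)
        then obtain \<pi> where \<pi>: "\<forall>a b. 0 \<le> \<pi> a b" "\<forall>u v. (u, v) \<notin> R \<inter> (A - {a}) \<times> B \<longrightarrow> \<pi> u v = 0"
          "\<forall>u\<in>A-{a}. (\<Sum>b\<in>B. \<pi> u b) = s' u" "\<forall>b\<in>B. (\<Sum>u\<in>A-{a}. \<pi> u b) \<le> t' b" by blast
        have "(\<Sum>u\<in>A. \<pi> u v) = (\<Sum>u\<in>A-{a}. \<pi> u v)" for v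
          using fin ab \<pi>(2) by (intro sum.mono_neutral_right) auto
        moreover have "(\<Sum>v\<in>B. \<pi> a v) = s' a" using \<pi>(2) 1 by (simp add: s'_def)
        ultimately have "\<forall>u\<in>A. (\<Sum>v\<in>B. \<pi> u v) = s' u" "\<forall>v\<in>B. (\<Sum>u\<in>A. \<pi> u v) \<le> t' v"
          using \<pi>(3,4) by auto
        thus ?thesis using \<pi>(1,2) by blast
      next
        case 2
        have "\<exists>\<pi>. (\<forall>a b. 0 \<le> \<pi> a b) \<and> (\<forall>u v. (u, v) \<notin> R \<inter> A \<times> (B - {b}) \<longrightarrow> \<pi> u v = 0) \<and>
          (\<forall>u\<in>A. (\<Sum>v\<in>B-{b}. \<pi> u v) = s' u) \<and> (\<forall>v\<in>B-{b}. (\<Sum>u\<in>A. \<pi> u v) \<le> t' v)"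
        proof (rule less.hyps)
          show "card A + card (B - {b}) < card A + card B"
            using card_Diff1_less[OF fin(2) ab(3)] by linarith
          fix S assume S: "S \<subseteq> A"
          have "sum t' (R `` S \<inter> B) = sum t' (R `` S \<inter> (B - {b}))"
            using fin 2 by (intro sum.mono_neutral_right) (auto simp: t'_def)
          thus "sum s' S \<le> sum t' (R `` S \<inter> (B - {b}))" using hall'[OF S] by simp
        qed (use fin s'0 t'0 in auto)
        then obtain \<pi> where \<pi>: "\<forall>a b. 0 \<le> \<pi> a b" "\<forall>u v. (u, v) \<notin> R \<inter> A \<times> (B - {b}) \<longrightarrow> \<pi> u v = 0"
          "\<forall>u\<in>A. (\<Sum>v\<in>B-{b}. \<pi> u v) = s' u" "\<forall>v\<in>B-{b}. (\<Sum>u\<in>A. \<pi> u v) \<le> t' v" by blast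
        have "(\<Sum>v\<in>B. \<pi> u v) = (\<Sum>v\<in>B-{b}. \<pi> u v)" for u
          using fin ab \<pi>(2) by (intro sum.mono_neutral_right) auto
        moreover have "(\<Sum>u\<in>A. \<pi> u b) \<le> t' b" using \<pi>(2) 2 by (simp add: t'_def)
        ultimately have "\<forall>u\<in>A. (\<Sum>v\<in>B. \<pi> u v) = s' u" "\<forall>v\<in>B. (\<Sum>u\<in>A. \<pi> u v) \<le> t' v"
          using \<pi>(3,4) by auto
        thus ?thesis using \<pi>(1,2) by blast
      next
        case (3 S)
        have SA: "S \<subseteq> A" "a \<notin> S" "b \<in> R `` S" using 3 by (auto simp: F_def)
        have tight: "sum s' S = sum t' (R `` S \<inter> B)" using 3 SA ab by (simp add: sum_s' sum_t')
        define B1 where "B1 = R `` S \<inter> B"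
        have finS: "finite S" "finite B1" using SA fin by (auto simp: B1_def intro: finite_subset)
        \<comment> \<open>Both halves have fewer supplies: \<open>a\<close> lies outside
          \<open>S\<close>, and \<open>S\<close> is nonempty because its image contains
          \<open>b\<close>. The demand sets need not shrink.\<close>
        have c1: "card S < card A" using SA ab fin by (intro psubset_card_mono) auto
        have c2: "card B1 \<le> card B" using fin by (auto simp: B1_def intro: card_mono)
        have c3: "card (A - S) < card A" using SA fin by (intro psubset_card_mono) auto
        have c4: "card (B - B1) \<le> card B" using fin by (auto intro: card_mono)
        have "\<exists>\<pi>. (\<forall>a b. 0 \<le> \<pi> a b) \<and> (\<forall>u v. (u, v) \<notin> R \<inter> S \<times> B1 \<longrightarrow> \<pi> u v = 0) \<and>
          (\<forall>u\<in>S. (\<Sum>v\<in>B1. \<pi> u v) = s' u) \<and> (\<forall>v\<in>B1. (\<Sum>u\<in>S. \<pi> u v) \<le> t' v)"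
        proof (rule less.hyps)
          fix S' assume "S' \<subseteq> S"
          moreover from this have "R `` S' \<inter> B1 = R `` S' \<inter> B" by (auto simp: B1_def)
          ultimately show "sum s' S' \<le> sum t' (R `` S' \<inter> B1)" using hall'[of S'] SA by auto
        qed (use fin SA s'0 t'0 c1 c2 finS in \<open>auto simp: B1_def\<close>)
        then obtain \<pi> where \<pi>: "\<forall>a b. 0 \<le> \<pi> a b" "\<forall>u v. (u, v) \<notin> R \<inter> S \<times> B1 \<longrightarrow> \<pi> u v = 0"
          "\<forall>u\<in>S. (\<Sum>v\<in>B1. \<pi> u v) = s' u" "\<forall>v\<in>B1. (\<Sum>u\<in>S. \<pi> u v) \<le> t' v" by blast
        have "\<exists>\<pi>. (\<forall>a b. 0 \<le> \<pi> a b) \<and> (\<forall>u v. (u, v) \<notin> R \<inter> (A - S) \<times> (B - B1) \<longrightarrow> \<pi> u v = 0) \<and>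
          (\<forall>u\<in>A-S. (\<Sum>v\<in>B-B1. \<pi> u v) = s' u) \<and> (\<forall>v\<in>B-B1. (\<Sum>u\<in>A-S. \<pi> u v) \<le> t' v)"
        proof (rule less.hyps)
          fix S' assume S': "S' \<subseteq> A - S"
          \<comment> \<open>Hall's condition for the remainder follows by adjoining the tight set
            \<open>S\<close> and cancelling its contribution.\<close>
          have "sum s' S' + sum s' S = sum s' (S' \<union> S)"
            using S' SA fin finS by (intro sum.union_disjoint[symmetric]) (auto intro: finite_subset)
          also have "\<dots> \<le> sum t' (R `` (S' \<union> S) \<inter> B)" using S' SA by (intro hall') auto
          also have "R `` (S' \<union> S) \<inter> B = (R `` S' \<inter> (B - B1)) \<union> B1" by (auto simp: B1_def)
          also have "sum t' \<dots> = sum t' (R `` S' \<inter> (B - B1)) + sum t' B1"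
            using fin finS by (intro sum.union_disjoint) auto
          finally show "sum s' S' \<le> sum t' (R `` S' \<inter> (B - B1))" using tight by (simp add: B1_def)
        qed (use fin s'0 t'0 c3 c4 in auto)
        then obtain \<rho> where \<rho>: "\<forall>a b. 0 \<le> \<rho> a b" "\<forall>u v. (u, v) \<notin> R \<inter> (A - S) \<times> (B - B1) \<longrightarrow> \<rho> u v = 0"
          "\<forall>u\<in>A-S. (\<Sum>v\<in>B-B1. \<rho> u v) = s' u" "\<forall>v\<in>B-B1. (\<Sum>u\<in>A-S. \<rho> u v) \<le> t' v" by blast
        have r1: "(\<Sum>v\<in>B. \<pi> u v) = (\<Sum>v\<in>B1. \<pi> u v)" for u
          using fin \<pi>(2) by (intro sum.mono_neutral_right) (auto simp: B1_def)
        have r2: "(\<Sum>v\<in>B. \<rho> u v) = (\<Sum>v\<in>B-B1. \<rho> u v)" for u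
          using fin \<rho>(2) by (intro sum.mono_neutral_right) auto
        have r3: "(\<Sum>u\<in>A. \<pi> u v) = (\<Sum>u\<in>S. \<pi> u v)" for v
          using fin \<pi>(2) SA by (intro sum.mono_neutral_right) auto
        have r4: "(\<Sum>u\<in>A. \<rho> u v) = (\<Sum>u\<in>A-S. \<rho> u v)" for v
          using fin \<rho>(2) by (intro sum.mono_neutral_right) auto
        have r5: "(\<Sum>v\<in>B. \<pi> u v + \<rho> u v) = s' u" if "u \<in> A" for u
          using that \<pi>(2,3) \<rho>(2,3) by (cases "u \<in> S") (auto simp: sum.distrib r1 r2)
        have r6: "(\<Sum>u\<in>A. \<pi> u v + \<rho> u v) \<le> t' v" if "v \<in> B" for v
          using that \<pi>(2,4) \<rho>(2,4) by (cases "v \<in> B1") (auto simp: sum.distrib r3 r4)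
        have "\<pi> u v = 0" "\<rho> u v = 0" if "(u, v) \<notin> R \<inter> A \<times> B" for u v
          using \<pi>(2)[rule_format, of u v] \<rho>(2)[rule_format, of u v] that SA by (auto simp: B1_def)
        thus ?thesis using \<pi>(1) \<rho>(1) r5 r6 by (intro exI[of _ "\<lambda>u v. \<pi> u v + \<rho> u v"]) auto
      qed
    qed
    then obtain \<pi> where \<pi>: "\<forall>a b. 0 \<le> \<pi> a b" "\<forall>a b. (a, b) \<notin> R \<inter> A \<times> B \<longrightarrow> \<pi> a b = 0"
      "\<forall>a\<in>A. (\<Sum>b\<in>B. \<pi> a b) = s' a" "\<forall>b\<in>B. (\<Sum>a\<in>A. \<pi> a b) \<le> t' b" by blast
    define \<rho> where "\<rho> u v = \<pi> u v + (if u = a \<and> v = b then \<epsilon> else 0)" for u v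
    have "(\<Sum>v\<in>B. \<rho> u v) = s u" if "u \<in> A" for u
      using that \<pi>(3) ab fin by (cases "u = a") (auto simp: \<rho>_def sum.distrib s'_def)
    moreover have "(\<Sum>u\<in>A. \<rho> u v) \<le> t v" if "v \<in> B" for v
      using that bspec[OF \<pi>(4) that] ab fin by (cases "v = b") (auto simp: \<rho>_def sum.distrib t'_def)
    ultimately show ?thesis using \<pi>(1,2) \<epsilon>0 ab by (intro exI[of _ \<rho>]) (auto simp: \<rho>_def)
  qed
qed

definition int_lipschitz :: "'a set \<Rightarrow> ('a \<Rightarrow> 'a \<Rightarrow> nat) \<Rightarrow> ('a \<Rightarrow> int) set" where
  "int_lipschitz X c = {f. \<forall>u\<in>X. \<forall>v\<in>X. f u - f v \<le> int (c u v)}"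

lemma int_lipschitzD: "f \<in> int_lipschitz X c \<Longrightarrow> u \<in> X \<Longrightarrow> v \<in> X \<Longrightarrow> f u - f v \<le> int (c u v)"
  by (simp add: int_lipschitz_def)

text \<open>Equal masses make the functional invariant under adding a constant to the potential.
  Normalised to vanish at a point \<open>z\<close>, integer potentials on a finite set are bounded
  by the costs to and from \<open>z\<close>, so only finitely many remain.\<close>

lemma int_lipschitz_attains_max:
  fixes \<mu> \<nu> :: "'a \<Rightarrow> real"
  assumes X: "finite X" and mass: "sum \<mu> X = sum \<nu> X"
  obtains f where "f \<in> int_lipschitz X c"
    "\<And>g. g \<in> int_lipschitz X c \<Longrightarrow> (\<Sum>u\<in>X. g u * (\<mu> u - \<nu> u)) \<le> (\<Sum>u\<in>X. f u * (\<mu> u - \<nu> u))"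
proof (cases "X = {}")
  case True
  show ?thesis by (rule that[of "\<lambda>_. 0"]) (use True in \<open>auto simp: int_lipschitz_def\<close>)
next
  case False
  then obtain z where z: "z \<in> X" by blast
  define \<Phi> where "\<Phi> g = (\<Sum>u\<in>X. of_int (g u) * (\<mu> u - \<nu> u))" for g :: "'a \<Rightarrow> int"
  \<comment> \<open>\<open>restrict\<close> fixes the values outside \<open>X\<close>; without it
    the normalised functions would not lie in the finite \<open>PiE\<close> set below.\<close>
  define N where "N g = restrict (\<lambda>u. g u - g z) X" for g :: "'a \<Rightarrow> int"
  have \<Phi>N: "\<Phi> (N g) = \<Phi> g" for g
  proof -
    have "\<Phi> (N g) = \<Phi> g - g z * (sum \<mu> X - sum \<nu> X)"
      by (simp add: \<Phi>_def N_def left_diff_distrib right_diff_distrib sum_subtractf sum_distrib_left)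
    thus ?thesis using mass by simp
  qed
  have "N ` int_lipschitz X c \<subseteq> (\<Pi>\<^sub>E u\<in>X. {- int (c z u)..int (c u z)})"
  proof (rule image_subsetI)
    fix g assume g: "g \<in> int_lipschitz X c"
    show "N g \<in> (\<Pi>\<^sub>E u\<in>X. {- int (c z u)..int (c u z)})"
      using int_lipschitzD[OF g _ z] int_lipschitzD[OF g z] by (fastforce simp: N_def)
  qed
  hence fin: "finite (\<Phi> ` N ` int_lipschitz X c)"
    
    using X by (intro finite_imageI[of "N ` _"]) (erule finite_subset, simp add: finite_PiE)
  have "(\<lambda>_. 0) \<in> int_lipschitz X c" by (simp add: int_lipschitz_def)
  hence ne: "\<Phi> ` N ` int_lipschitz X c \<noteq> {}" by blast
  obtain f where f: "f \<in> int_lipschitz X c" "\<Phi> (N f) = Max (\<Phi> ` N ` int_lipschitz X c)"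
    using Min_in Max_in[OF fin ne] by (auto simp: image_iff)
  show ?thesis
  proof (rule that[OF f(1)])
    fix g assume "g \<in> int_lipschitz X c"
    hence "\<Phi> (N g) \<le> \<Phi> (N f)" unfolding f(2) by (intro Max_ge fin) auto
    thus "(\<Sum>u\<in>X. g u * (\<mu> u - \<nu> u)) \<le> (\<Sum>u\<in>X. f u * (\<mu> u - \<nu> u))" unfolding \<Phi>N unfolding \<Phi>_def .
  qed
qed

text \<open>For an optimal potential \<open>f\<close>, Hall's condition holds for the relation of tight pairs: this relation is
  transitive, so a violating set could be closed under it, and raising \<open>f\<close> by \<open>1\<close> there
  would improve \<open>f\<close>.\<close>

theorem integral_kantorovich_duality:
  fixes \<mu> \<nu> :: "'a \<Rightarrow> real" and c :: "'a \<Rightarrow> 'a \<Rightarrow> nat"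
  assumes X: "finite X" and mass: "sum \<mu> X = sum \<nu> X"
    and nonneg: "\<And>u. u \<in> X \<Longrightarrow> 0 \<le> \<mu> u" "\<And>u. u \<in> X \<Longrightarrow> 0 \<le> \<nu> u"
    and refl: "\<And>u. u \<in> X \<Longrightarrow> c u u = 0"
    and tri: "\<And>u v w. u \<in> X \<Longrightarrow> v \<in> X \<Longrightarrow> w \<in> X \<Longrightarrow> c u w \<le> c u v + c v w"
  obtains f :: "'a \<Rightarrow> int" and \<pi> :: "'a \<Rightarrow> 'a \<Rightarrow> real" where "f \<in> int_lipschitz X c"
    "\<And>u v. 0 \<le> \<pi> u v" "\<And>u v. u \<notin> X \<or> v \<notin> X \<Longrightarrow> \<pi> u v = 0"
    "\<And>u. u \<in> X \<Longrightarrow> (\<Sum>v\<in>X. \<pi> u v) = \<mu> u" "\<And>v. v \<in> X \<Longrightarrow> (\<Sum>u\<in>X. \<pi> u v) = \<nu> v"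
    "(\<Sum>u\<in>X. \<Sum>v\<in>X. c u v * \<pi> u v) = (\<Sum>u\<in>X. f u * (\<mu> u - \<nu> u))"
proof -
  obtain f where f: "f \<in> int_lipschitz X c"
    "\<And>g. g \<in> int_lipschitz X c \<Longrightarrow> (\<Sum>u\<in>X. g u * (\<mu> u - \<nu> u)) \<le> (\<Sum>u\<in>X. f u * (\<mu> u - \<nu> u))"
    using int_lipschitz_attains_max[OF X mass] by blast
  define R where "R = {(u, v). u \<in> X \<and> v \<in> X \<and> f u - f v = int (c u v)}"
  have hall: "sum \<mu> S \<le> sum \<nu> (R `` S \<inter> X)" if S: "S \<subseteq> X" for S
  proof -
    define U where "U = R `` S"
    have "U \<subseteq> X" by (auto simp: U_def R_def)
    moreover have "(u, u) \<in> R" if "u \<in> S" for u using that S refl by (auto simp: R_def)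
    hence "S \<subseteq> U" by (auto simp: U_def)
    ultimately have U: "U \<subseteq> X" "S \<subseteq> U" .
    have closed: "v \<in> U" if "(u, v) \<in> R" "u \<in> U" for u v
    proof -
      obtain w where w: "w \<in> S" "(w, u) \<in> R" using \<open>u \<in> U\<close> by (auto simp: U_def)
      have X3: "w \<in> X" "u \<in> X" "v \<in> X" using w that by (auto simp: R_def)
      have "f w - f v = int (c w v)"
        using int_lipschitzD[OF f(1), of w v] tri[of w u v] X3 w that by (auto simp: R_def)
      hence "(w, v) \<in> R" using X3 by (simp add: R_def)
      thus ?thesis using w by (auto simp: U_def)
    qed
    define g where "g u = f u + (if u \<in> U then 1 else 0)" for u
    have "g \<in> int_lipschitz X c" unfolding int_lipschitz_def
    proof (intro CollectI ballI)
      fix u v assume uv: "u \<in> X" "v \<in> X"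
      \<comment> \<open>Integrality enters here: a bound that is not tight has slack at least
        \<open>1\<close>, so the unit step keeps it.\<close>
      have "f u - f v \<noteq> int (c u v)" if "u \<in> U" "v \<notin> U"
        using closed[of u v] that uv by (auto simp: R_def)
      thus "g u - g v \<le> int (c u v)" using int_lipschitzD[OF f(1) uv] by (auto simp: g_def)
    qed
    from f(2)[OF this] have "(\<Sum>u\<in>X. of_int (if u \<in> U then 1 else 0) * (\<mu> u - \<nu> u)) \<le> 0"
      by (simp add: g_def distrib_right sum.distrib)
    also have "(\<Sum>u\<in>X. of_int (if u \<in> U then 1 else 0) * (\<mu> u - \<nu> u)) = (\<Sum>u\<in>X. if u \<in> U then \<mu> u - \<nu> u else 0)"
      by (rule sum.cong) auto
    also have "\<dots> = (\<Sum>u\<in>U. \<mu> u - \<nu> u)"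
      using X U by (subst sum.inter_restrict[symmetric]) (auto simp: Int_absorb1)
    finally have "sum \<mu> U \<le> sum \<nu> U" by (simp add: sum_subtractf)
    moreover have "sum \<mu> S \<le> sum \<mu> U" using X U nonneg by (intro sum_mono2) (auto intro: finite_subset)
    ultimately show ?thesis using U by (simp add: U_def Int_absorb2)
  qed
  obtain \<pi> where \<pi>: "\<And>u v. 0 \<le> \<pi> u v" "\<And>u v. (u, v) \<notin> R \<inter> X \<times> X \<Longrightarrow> \<pi> u v = 0"
    "\<And>u. u \<in> X \<Longrightarrow> (\<Sum>v\<in>X. \<pi> u v) = \<mu> u" "\<And>v. v \<in> X \<Longrightarrow> (\<Sum>u\<in>X. \<pi> u v) \<le> \<nu> v"
    using fractional_hall[of X X \<mu> \<nu> R] X nonneg hall by blast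
  \<comment> \<open>Hall's condition bounds the columns only from above; since the total masses
    agree, every one of these bounds is an equality.\<close>
  have total: "(\<Sum>v\<in>X. \<Sum>u\<in>X. \<pi> u v) = sum \<nu> X"
    using \<pi>(3) mass by (subst sum.swap) simp
  have marg: "(\<Sum>u\<in>X. \<pi> u v) = \<nu> v" if "v \<in> X" for v
    by (rule sum_mono_inv[OF total]) (use that X \<pi>(4) in auto)
  \<comment> \<open>Complementary slackness: the plan is supported on pairs where the cost equals
    the difference of the potential.\<close>
  have "(\<Sum>u\<in>X. \<Sum>v\<in>X. c u v * \<pi> u v) = (\<Sum>u\<in>X. \<Sum>v\<in>X. f u * \<pi> u v - f v * \<pi> u v)"
  proof (intro sum.cong refl)
    fix u v
    have "real (c u v) = real_of_int (f u) - real_of_int (f v)" if "(u, v) \<in> R"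
      using that by (simp add: R_def flip: of_int_diff)
    thus "c u v * \<pi> u v = f u * \<pi> u v - f v * \<pi> u v"
      using \<pi>(2)[of u v] by (cases "(u, v) \<in> R") (auto simp: left_diff_distrib)
  qed auto
  also have "\<dots> = (\<Sum>u\<in>X. \<Sum>v\<in>X. f u * \<pi> u v) - (\<Sum>v\<in>X. \<Sum>u\<in>X. f v * \<pi> u v)"
    by (subst (2) sum.swap) (simp add: sum_subtractf)
  also have "\<dots> = (\<Sum>u\<in>X. f u * (\<mu> u - \<nu> u))"
    by (simp add: sum_distrib_left[symmetric] \<pi>(3) marg sum_subtractf right_diff_distrib)
  finally show ?thesis using that[OF f(1), of \<pi>] \<pi> marg by auto
qed

subsection \<open>Wasserstein distance of finitely supported measures\<close>

text \<open>The form of \<open>graph_dist\<close> that can serve as a \<open>nat\<close>-valued cost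
  in the duality theorem. If no walk exists, \<open>LEAST\<close> gives an unspecified number, so
  the two are compared only for connected pairs.\<close>

definition walk_dist :: "('a \<Rightarrow> 'a \<Rightarrow> bool) \<Rightarrow> 'a \<Rightarrow> 'a \<Rightarrow> nat" where
  "walk_dist E u v = (LEAST n. (E ^^ n) u v)"

lemma walk_dist_le: "(E ^^ n) u v \<Longrightarrow> walk_dist E u v \<le> n"
  unfolding walk_dist_def by (rule Least_le)

lemma walk_dist_walk: "E\<^sup>*\<^sup>* u v \<Longrightarrow> (E ^^ walk_dist E u v) u v"
  unfolding walk_dist_def by (metis rtranclp_imp_relpowp LeastI)

lemma walk_dist_same [simp]: "walk_dist E u u = 0"
  using walk_dist_le[of 0 E u u] by simp

lemma walk_dist_triangle:
  assumes "E\<^sup>*\<^sup>* u v" "E\<^sup>*\<^sup>* v w"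
  shows "walk_dist E u w \<le> walk_dist E u v + walk_dist E v w"
  using assms by (intro walk_dist_le) (auto simp: relpowp_add intro!: relcomppI walk_dist_walk)

lemma walk_dist_eq_0D: "E\<^sup>*\<^sup>* u v \<Longrightarrow> walk_dist E u v = 0 \<Longrightarrow> u = v"
  using walk_dist_walk[of E u v] by simp

lemma walk_dist_eq_1D: "E\<^sup>*\<^sup>* u v \<Longrightarrow> walk_dist E u v = 1 \<Longrightarrow> E u v"
  using walk_dist_walk[of E u v] by auto

lemma graph_dist_eq_walk_dist:
  assumes "E\<^sup>*\<^sup>* u v"
  shows "graph_dist E u v = enat (walk_dist E u v)"
  unfolding graph_dist_def
  by (rule antisym) (auto intro!: INF_lower INF_greatest walk_dist_walk walk_dist_le assms)

context simple_graph
begin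

lemma walk_rev: "(E ^^ n) u v \<Longrightarrow> (E ^^ n) v u"
  by (induction n arbitrary: v) (auto elim!: relpowp_Suc_E intro: relpowp_Suc_I2 adj_sym simp del: relpowp.simps(2))

lemma walk_dist_commute: "walk_dist E u v = walk_dist E v u"
  unfolding walk_dist_def by (metis walk_rev)

end

text \<open>Nonnegative entries with sum zero vanish. This confines all couplings of finitely
  supported measures to one finite block.\<close>

lemma coupling_eq_0:
  assumes \<pi>: "\<pi> \<in> couplings V \<mu> \<nu>" and uv: "u \<in> V" "v \<in> V" and "\<mu> u = 0 \<or> \<nu> v = 0"
  shows "\<pi> u v = 0"
  using assms(4)
proof
  assume "\<mu> u = 0"
  hence "((\<lambda>v. \<pi> u v) has_sum 0) V" using \<pi> uv by (auto simp: couplings_def dest: bspec)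
  thus ?thesis by (rule nonneg_has_sum_le_0D) (use \<pi> uv in \<open>auto simp: couplings_def\<close>)
next
  assume "\<nu> v = 0"
  hence "((\<lambda>u. \<pi> u v) has_sum 0) V" using \<pi> uv by (auto simp: couplings_def dest: bspec)
  thus ?thesis by (rule nonneg_has_sum_le_0D) (use \<pi> uv in \<open>auto simp: couplings_def\<close>)
qed

text \<open>Passes from the \<open>ennreal\<close> cost in the definition to a finite real sum.
  Outside the block a possibly infinite distance is multiplied by \<open>0\<close> and drops
  out.\<close>

lemma transport_cost_finite_support:
  fixes \<pi> :: "'a \<Rightarrow> 'a \<Rightarrow> real"
  assumes X: "finite X" "X \<subseteq> V" and conn: "\<And>u v. u \<in> X \<Longrightarrow> v \<in> X \<Longrightarrow> E\<^sup>*\<^sup>* u v"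
    and nonneg: "\<And>u v. u \<in> X \<Longrightarrow> v \<in> X \<Longrightarrow> 0 \<le> \<pi> u v"
    and zero: "\<And>u v. u \<in> V \<Longrightarrow> v \<in> V \<Longrightarrow> u \<notin> X \<or> v \<notin> X \<Longrightarrow> \<pi> u v = 0"
  shows "(\<Sum>\<^sub>\<infinity>u\<in>V. \<Sum>\<^sub>\<infinity>v\<in>V. ennreal_of_enat (graph_dist E u v) * ennreal (\<pi> u v)) =
    ennreal (\<Sum>u\<in>X. \<Sum>v\<in>X. walk_dist E u v * \<pi> u v)"
proof -
  let ?c = "\<lambda>u v. ennreal_of_enat (graph_dist E u v) * ennreal (\<pi> u v)"
  have "(\<Sum>\<^sub>\<infinity>u\<in>V. \<Sum>\<^sub>\<infinity>v\<in>V. ?c u v) = (\<Sum>\<^sub>\<infinity>u\<in>X. \<Sum>\<^sub>\<infinity>v\<in>X. ?c u v)"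
  proof (rule infsum_cong_neutral)
    fix u assume "u \<in> V - X"
    hence "(\<Sum>\<^sub>\<infinity>v\<in>V. ?c u v) = (\<Sum>\<^sub>\<infinity>v\<in>V. 0)" by (intro infsum_cong) (simp add: zero)
    thus "(\<Sum>\<^sub>\<infinity>v\<in>V. ?c u v) = 0" by simp
  next
    fix u assume "u \<in> V \<inter> X"
    thus "(\<Sum>\<^sub>\<infinity>v\<in>V. ?c u v) = (\<Sum>\<^sub>\<infinity>v\<in>X. ?c u v)"
      by (intro infsum_cong_neutral) (use X in \<open>auto simp: zero\<close>)
  qed (use X in auto)
  also have "\<dots> = (\<Sum>u\<in>X. \<Sum>v\<in>X. ?c u v)" using X by simp
  also have "\<dots> = (\<Sum>u\<in>X. \<Sum>v\<in>X. ennreal (walk_dist E u v * \<pi> u v))"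
    by (intro sum.cong refl) (simp add: graph_dist_eq_walk_dist conn nonneg ennreal_mult ennreal_of_nat_eq_real_of_nat)
  also have "\<dots> = ennreal (\<Sum>u\<in>X. \<Sum>v\<in>X. walk_dist E u v * \<pi> u v)"
    by (simp add: nonneg sum_nonneg)
  finally show ?thesis .
qed

text \<open>The optimal plan of the integral duality gives the upper bound, and weak duality against
  an arbitrary coupling gives the lower one. Together the conclusions say that the distance is a
  maximum over integer potentials, attained at \<open>f\<close>.\<close>

lemma wasserstein_eq_dual:
  fixes \<mu> \<nu> :: "'a \<Rightarrow> real"
  assumes X: "finite X" "X \<subseteq> V" and conn: "\<And>u v. u \<in> X \<Longrightarrow> v \<in> X \<Longrightarrow> E\<^sup>*\<^sup>* u v"
    and nonneg: "\<And>u. 0 \<le> \<mu> u" "\<And>u. 0 \<le> \<nu> u"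
    and zero: "\<And>u. u \<notin> X \<Longrightarrow> \<mu> u = 0" "\<And>u. u \<notin> X \<Longrightarrow> \<nu> u = 0"
    and mass: "sum \<mu> X = 1" "sum \<nu> X = 1"
  obtains f where "f \<in> int_lipschitz X (walk_dist E)"
    "enn2real (wasserstein V E \<mu> \<nu>) = (\<Sum>u\<in>X. f u * (\<mu> u - \<nu> u))"
    "\<And>g. g \<in> int_lipschitz X (walk_dist E) \<Longrightarrow>
       (\<Sum>u\<in>X. g u * (\<mu> u - \<nu> u)) \<le> enn2real (wasserstein V E \<mu> \<nu>)"
proof -
  let ?d = "walk_dist E" and ?\<Phi> = "\<lambda>g. \<Sum>u\<in>X. real_of_int (g u) * (\<mu> u - \<nu> u)"
  let ?C = "\<lambda>\<pi>. \<Sum>\<^sub>\<infinity>u\<in>V. \<Sum>\<^sub>\<infinity>v\<in>V. ennreal_of_enat (graph_dist E u v) * ennreal (\<pi> u v)"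
  obtain f :: "'a \<Rightarrow> int" and \<pi> :: "'a \<Rightarrow> 'a \<Rightarrow> real" where f: "f \<in> int_lipschitz X ?d"
    and \<pi>: "\<And>u v. 0 \<le> \<pi> u v" "\<And>u v. u \<notin> X \<or> v \<notin> X \<Longrightarrow> \<pi> u v = 0"
      "\<And>u. u \<in> X \<Longrightarrow> (\<Sum>v\<in>X. \<pi> u v) = \<mu> u" "\<And>v. v \<in> X \<Longrightarrow> (\<Sum>u\<in>X. \<pi> u v) = \<nu> v"
    and opt: "(\<Sum>u\<in>X. \<Sum>v\<in>X. ?d u v * \<pi> u v) = ?\<Phi> f"
    by (rule integral_kantorovich_duality[of X \<mu> \<nu> ?d])
      (use X mass nonneg in \<open>auto intro: walk_dist_triangle conn\<close>)
  \<comment> \<open>Needed for the passage between \<open>real\<close> and \<open>ennreal\<close>,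
    since \<open>ennreal\<close> truncates negative numbers to \<open>0\<close>.\<close>
  have f0: "0 \<le> ?\<Phi> f" unfolding opt[symmetric] by (intro sum_nonneg mult_nonneg_nonneg) (auto simp: \<pi>)
  have rows: "((\<lambda>v. \<pi> u v) has_sum \<mu> u) V" for u
  proof (rule has_sum_finite_neutralI[OF X])
    show "\<mu> u = sum (\<pi> u) X" using \<pi>(2,3) zero by (cases "u \<in> X") auto
  qed (use \<pi> in auto)
  have cols: "((\<lambda>u. \<pi> u v) has_sum \<nu> v) V" for v
  proof (rule has_sum_finite_neutralI[OF X])
    show "\<nu> v = (\<Sum>u\<in>X. \<pi> u v)" using \<pi>(2,4) zero by (cases "v \<in> X") auto
  qed (use \<pi> in auto)
  have le1: "\<pi> u v \<le> 1" for u v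
  proof (cases "u \<in> X \<and> v \<in> X")
    case True
    have "\<pi> u v \<le> (\<Sum>v\<in>X. \<pi> u v)" using True X \<pi> by (intro member_le_sum) auto
    also have "\<dots> \<le> sum \<mu> X" unfolding \<pi>(3)[OF conjunct1[OF True]]
      using True X nonneg by (intro member_le_sum) auto
    finally show ?thesis using mass by simp
  qed (use \<pi>(2) in auto)
  have "\<pi> \<in> couplings V \<mu> \<nu>" using rows cols le1 \<pi>(1) by (auto simp: couplings_def)
  hence "wasserstein V E \<mu> \<nu> \<le> ?C \<pi>" unfolding wasserstein_def by (rule INF_lower)
  also have "\<dots> = ennreal (?\<Phi> f)"
    unfolding opt[symmetric] by (rule transport_cost_finite_support) (use X conn \<pi> in auto)
  finally have upper: "wasserstein V E \<mu> \<nu> \<le> ennreal (?\<Phi> f)" .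
  \<comment> \<open>Weak duality: the marginals of any coupling turn the dual value into a sum of
    differences of \<open>g\<close>, which the Lipschitz condition bounds by the cost.\<close>
  have lower: "ennreal (?\<Phi> g) \<le> wasserstein V E \<mu> \<nu>" if g: "g \<in> int_lipschitz X ?d" for g
    unfolding wasserstein_def
  proof (rule INF_greatest)
    fix \<rho> assume \<rho>: "\<rho> \<in> couplings V \<mu> \<nu>"
    have \<rho>0: "\<rho> u v = 0" if "u \<in> V" "v \<in> V" "u \<notin> X \<or> v \<notin> X" for u v
      using coupling_eq_0[OF \<rho> that(1,2)] that(3) zero by blast
    have nonneg\<rho>: "0 \<le> \<rho> u v" if "u \<in> X" "v \<in> X" for u v
      using \<rho> subsetD[OF X(2) that(1)] subsetD[OF X(2) that(2)] by (auto simp: couplings_def)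
    have rows: "(\<Sum>v\<in>X. \<rho> u v) = \<mu> u" if "u \<in> X" for u
    proof -
      have "((\<lambda>v. \<rho> u v) has_sum (\<Sum>v\<in>X. \<rho> u v)) V"
        by (rule has_sum_finite_neutralI[OF X]) (use \<rho>0 X that in auto)
      moreover have "((\<lambda>v. \<rho> u v) has_sum \<mu> u) V" using \<rho> X that by (auto simp: couplings_def)
      ultimately show ?thesis by (rule has_sum_unique)
    qed
    have cols: "(\<Sum>u\<in>X. \<rho> u v) = \<nu> v" if "v \<in> X" for v
    proof -
      have "((\<lambda>u. \<rho> u v) has_sum (\<Sum>u\<in>X. \<rho> u v)) V"
        by (rule has_sum_finite_neutralI[OF X]) (use \<rho>0 X that in auto)
      moreover have "((\<lambda>u. \<rho> u v) has_sum \<nu> v) V" using \<rho> X that by (auto simp: couplings_def)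
      ultimately show ?thesis by (rule has_sum_unique)
    qed
    have "?\<Phi> g = (\<Sum>u\<in>X. \<Sum>v\<in>X. g u * \<rho> u v) - (\<Sum>v\<in>X. \<Sum>u\<in>X. g v * \<rho> u v)"
      by (simp add: sum_distrib_left[symmetric] rows cols sum_subtractf right_diff_distrib)
    also have "\<dots> = (\<Sum>u\<in>X. \<Sum>v\<in>X. (g u - g v) * \<rho> u v)"
      by (subst (2) sum.swap) (simp add: sum_subtractf left_diff_distrib)
    also have "\<dots> \<le> (\<Sum>u\<in>X. \<Sum>v\<in>X. ?d u v * \<rho> u v)"
    proof (intro sum_mono mult_right_mono nonneg\<rho>)
      fix u v assume "u \<in> X" "v \<in> X"
      hence "g u - g v \<le> int (?d u v)" by (rule int_lipschitzD[OF g])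
      thus "real_of_int (g u - g v) \<le> real (?d u v)" by linarith
    qed
    finally have "ennreal (?\<Phi> g) \<le> ennreal (\<Sum>u\<in>X. \<Sum>v\<in>X. ?d u v * \<rho> u v)" by (rule ennreal_leI)
    also have "\<dots> = ?C \<rho>"
      by (rule transport_cost_finite_support[symmetric]) (use X conn \<rho>0 nonneg\<rho> in auto)
    finally show "ennreal (?\<Phi> g) \<le> ?C \<rho>" .
  qed
  have "wasserstein V E \<mu> \<nu> = ennreal (?\<Phi> f)" using upper lower[OF f] by (rule antisym)
  hence W: "enn2real (wasserstein V E \<mu> \<nu>) = ?\<Phi> f" using f0 by simp
  have "?\<Phi> g \<le> ?\<Phi> f" if "g \<in> int_lipschitz X ?d" for g
    using lower[OF that] upper f0 by (meson ennreal_le_iff order_trans)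
  thus ?thesis using that[OF f W] W by simp
qed

subsection \<open>Integer potentials around an edge\<close>

definition nbr_mean :: "('a \<Rightarrow> 'a \<Rightarrow> bool) \<Rightarrow> ('a \<Rightarrow> int) \<Rightarrow> 'a \<Rightarrow> real" where
  "nbr_mean E f x = real_of_int (\<Sum>z | E x z. f z) / real (vertex_degree E x)"

text \<open>The dual functional at idleness \<open>0\<close>, written \<open>A f\<close> in the
  overview.\<close>

definition mean_gap :: "('a \<Rightarrow> 'a \<Rightarrow> bool) \<Rightarrow> 'a \<Rightarrow> 'a \<Rightarrow> ('a \<Rightarrow> int) \<Rightarrow> real" where
  "mean_gap E x y f = nbr_mean E f x - nbr_mean E f y"

text \<open>For adjacent \<open>x\<close> and \<open>y\<close> this is the union of the two unit
  balls, as each endpoint is a neighbour of the other.\<close>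

definition edge_nbhd :: "('a \<Rightarrow> 'a \<Rightarrow> bool) \<Rightarrow> 'a \<Rightarrow> 'a \<Rightarrow> 'a set" where
  "edge_nbhd E x y = {z. E x z} \<union> {z. E y z}"

text \<open>The Lipschitz condition refers to distances in the whole graph, not in the induced
  subgraph.\<close>

definition potentials :: "('a \<Rightarrow> 'a \<Rightarrow> bool) \<Rightarrow> 'a \<Rightarrow> 'a \<Rightarrow> ('a \<Rightarrow> int) set" where
  "potentials E x y = int_lipschitz (edge_nbhd E x y) (walk_dist E)"

lemma potentials_commute: "potentials E x y = potentials E y x"
  by (simp add: potentials_def edge_nbhd_def Un_commute)

lemma mean_gap_uminus_commute: "mean_gap E x y (\<lambda>u. - f u) = mean_gap E y x f"
  by (simp add: mean_gap_def nbr_mean_def sum_negf)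

section \<open>Means over neighbours and the dual formula for an edge\<close>

context locally_finite_graph
begin

lemma vertex_degree_pos:
  assumes "E x y" shows "0 < vertex_degree E x"
proof -
  have "finite {z. E x z}" using assms adj_in_V locally_finite by blast
  thus ?thesis using assms by (auto simp: vertex_degree_def card_gt_0_iff)
qed

lemma finite_nbrs: "finite {z. E x z}"
  using adj_in_V locally_finite[of x] by (cases "x \<in> V") (auto intro: rev_finite_subset[of "{}"])

lemma nbr_mean_const:
  assumes "E x y" shows "nbr_mean E (\<lambda>_. C) x = C"
  using vertex_degree_pos[OF assms] by (simp add: nbr_mean_def vertex_degree_def)

lemma nbr_mean_add: "nbr_mean E (\<lambda>u. f u + g u) x = nbr_mean E f x + nbr_mean E g x"
  by (simp add: nbr_mean_def sum.distrib add_divide_distrib)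

lemma nbr_mean_diff_indicator:
  "nbr_mean E (\<lambda>u. f u - of_bool (u \<in> S)) x =
     nbr_mean E f x - card (S \<inter> {z. E x z}) / vertex_degree E x"
proof -
  have "(\<Sum>z | E x z. of_bool (z \<in> S)) = int (card (S \<inter> {z. E x z}))"
    using finite_nbrs[of x] by (simp add: Int_commute)
  thus ?thesis by (simp add: nbr_mean_def sum_subtractf diff_divide_distrib)
qed

lemma sum_walk_measure:
  assumes X: "finite X" "x \<in> X" "{z. E x z} \<subseteq> X"
  shows "(\<Sum>u\<in>X. real_of_int (f u) * walk_measure E p x u) = p * f x + (1 - p) * nbr_mean E f x"
proof -
  have "(\<Sum>u\<in>X. f u * walk_measure E p x u) = (\<Sum>u\<in>insert x {z. E x z}. f u * walk_measure E p x u)"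
    using X by (intro sum.mono_neutral_right) (auto simp: walk_measure_def)
  also have "\<dots> = p * f x + (\<Sum>z | E x z. f z * walk_measure E p x z)"
    using finite_nbrs no_loops by (simp add: walk_measure_def)
  also have "(\<Sum>z | E x z. f z * walk_measure E p x z) = (\<Sum>z | E x z. (1 - p) / vertex_degree E x * f z)"
    by (intro sum.cong) (use no_loops in \<open>auto simp: walk_measure_def\<close>)
  also have "\<dots> = (1 - p) * nbr_mean E f x"
    by (simp only: sum_distrib_left[symmetric] nbr_mean_def of_int_sum) simp
  finally show ?thesis .
qed

lemma finite_edge_nbhd: "finite (edge_nbhd E x y)"
  by (simp add: edge_nbhd_def finite_nbrs)

text \<open>Ensures that \<open>walk_dist\<close> is a genuine finite distance on the neighbourhood,
  obeying the triangle inequality.\<close>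

lemma edge_nbhd_connected:
  assumes "E x y" "u \<in> edge_nbhd E x y" "v \<in> edge_nbhd E x y"
  shows "E\<^sup>*\<^sup>* u v"
proof -
  have "E\<^sup>*\<^sup>* w x \<and> E\<^sup>*\<^sup>* x w" if "w \<in> edge_nbhd E x y" for w
  proof -
    consider "E x w" | "E y w" using \<open>w \<in> edge_nbhd E x y\<close> by (auto simp: edge_nbhd_def)
    thus ?thesis
    proof cases
      case 1
      from r_into_rtranclp[of E, OF this] r_into_rtranclp[of E, OF adj_sym[OF this]]
      show ?thesis by simp
    next
      case 2
      have "E\<^sup>*\<^sup>* w y" "E\<^sup>*\<^sup>* y w" "E\<^sup>*\<^sup>* y x" "E\<^sup>*\<^sup>* x y"
        by (rule r_into_rtranclp, rule 2 adj_sym[OF 2] assms(1) adj_sym[OF assms(1)])+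
      thus ?thesis by (meson rtranclp_trans)
    qed
  qed
  thus ?thesis using assms(2,3) by (meson rtranclp_trans)
qed

lemma walk_dist_adj_le: "E u v \<Longrightarrow> walk_dist E u v \<le> 1"
  by (rule walk_dist_le) (simp only: relpowp_1)

lemma walk_dist_adj:
  assumes "E u v" shows "walk_dist E u v = 1"
proof -
  have "walk_dist E u v \<noteq> 0" using walk_dist_eq_0D[of E u v] assms no_loops by blast
  thus ?thesis using walk_dist_adj_le[OF assms] by linarith
qed

text \<open>Each potential contributes an affine function of \<open>p\<close>, and the set of
  potentials does not depend on \<open>p\<close>. Hence the distance is a maximum of a fixed family
  of lines.\<close>

lemma wasserstein_walk_measure_eq:
  assumes xy: "E x y" and p: "p \<in> {0..1}"
  obtains f where "f \<in> potentials E x y"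
    "enn2real (wasserstein V E (walk_measure E p x) (walk_measure E p y)) =
       p * (f x - f y) + (1 - p) * mean_gap E x y f"
    "\<And>g. g \<in> potentials E x y \<Longrightarrow> p * (g x - g y) + (1 - p) * mean_gap E x y g \<le>
       enn2real (wasserstein V E (walk_measure E p x) (walk_measure E p y))"
proof -
  let ?X = "edge_nbhd E x y"
  have yx: "E y x" using xy adj_sym by blast
  have X: "x \<in> ?X" "y \<in> ?X" "{z. E x z} \<subseteq> ?X" "{z. E y z} \<subseteq> ?X" "?X \<subseteq> V"
    using xy yx adj_in_V by (auto simp: edge_nbhd_def)
  have \<Phi>: "(\<Sum>u\<in>?X. real_of_int (g u) * (walk_measure E p x u - walk_measure E p y u)) =
      p * (g x - g y) + (1 - p) * mean_gap E x y g" for g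
    using sum_walk_measure[OF finite_edge_nbhd X(1,3), of g p] sum_walk_measure[OF finite_edge_nbhd X(2,4), of g p]
    by (simp add: right_diff_distrib sum_subtractf mean_gap_def)
  \<comment> \<open>Total mass is the integral of the constant function \<open>1\<close>.\<close>
  have mass: "sum (walk_measure E p x) ?X = 1" "sum (walk_measure E p y) ?X = 1"
    using sum_walk_measure[OF finite_edge_nbhd X(1,3), of "\<lambda>_. 1" p] nbr_mean_const[OF xy, of 1]
      sum_walk_measure[OF finite_edge_nbhd X(2,4), of "\<lambda>_. 1" p] nbr_mean_const[OF yx, of 1] by auto
  show ?thesis
  proof (rule wasserstein_eq_dual[OF finite_edge_nbhd X(5), of E "walk_measure E p x" "walk_measure E p y"])
    fix u assume "u \<notin> ?X"
    thus "walk_measure E p x u = 0" "walk_measure E p y u = 0"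
      using X by (auto simp: walk_measure_def)
  qed (use edge_nbhd_connected[OF xy] walk_measure_nonneg[OF p] mass that \<Phi> in \<open>auto simp: potentials_def\<close>)
qed

section \<open>Operations on potentials: negation, rounded midpoint, lowering\<close>

lemma uminus_potentials: "f \<in> potentials E x y \<Longrightarrow> (\<lambda>u. - f u) \<in> potentials E x y"
  by (force simp: potentials_def int_lipschitz_def walk_dist_commute)

lemma edge_potential_range:
  assumes "E x y" "f \<in> potentials E x y"
  shows "f x - f y \<in> {-1, 0, 1}"
proof -
  have yx: "E y x" using assms adj_sym by blast
  have "x \<in> edge_nbhd E x y" "y \<in> edge_nbhd E x y" using assms(1) yx by (auto simp: edge_nbhd_def)
  hence "f x - f y \<le> 1" "f y - f x \<le> 1"
    using assms(2) walk_dist_adj[OF assms(1)] walk_dist_adj[OF yx]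
    unfolding potentials_def int_lipschitz_def by fastforce+
  thus ?thesis by auto
qed

text \<open>The average of \<open>f\<close> and \<open>g\<close> is half-integral. Rounding it down
  and up preserves the integer Lipschitz bounds and keeps the sum \<open>f + g\<close>, and this sum
  agrees at \<open>x\<close> and \<open>y\<close>. This yields the discrete concavity of the three
  coefficients.\<close>

lemma potentials_midpoint:
  assumes xy: "E x y" and f: "f \<in> potentials E x y" "f x - f y = 1"
    and g: "g \<in> potentials E x y" "g x - g y = -1"
  obtains h k where "h \<in> potentials E x y" "h x = h y" "k \<in> potentials E x y" "k x = k y"
    "mean_gap E x y h + mean_gap E x y k = mean_gap E x y f + mean_gap E x y g"
proof -
  define s where "s u = f u + g u" for u
  define h where "h u = s u div 2" for u
  define k where "k u = (s u + 1) div 2" for u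
  have yx: "E y x" using xy adj_sym by blast
  have s: "s u - s v \<le> 2 * int (walk_dist E u v)" if "u \<in> edge_nbhd E x y" "v \<in> edge_nbhd E x y" for u v
    using f(1) g(1) that by (force simp: s_def potentials_def int_lipschitz_def)
  have "a div 2 - b div 2 \<le> n" if "a - b \<le> 2 * n" for a b n :: int
    using that by linarith
  hence "h \<in> potentials E x y" "k \<in> potentials E x y"
    using s by (auto simp: h_def k_def potentials_def int_lipschitz_def)
  moreover have "s x = s y" using f(2) g(2) by (simp add: s_def)
  hence "h x = h y" "k x = k y" by (simp_all add: h_def k_def)
  moreover have "(\<lambda>u. h u + k u) = (\<lambda>u. f u + g u)"
    unfolding h_def k_def s_def by (rule ext) linarith
  from arg_cong[OF this, of "mean_gap E x y"]
  have "mean_gap E x y h + mean_gap E x y k = mean_gap E x y f + mean_gap E x y g"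
    by (simp add: mean_gap_def nbr_mean_add)
  ultimately show ?thesis using that by blast
qed

text \<open>Lower \<open>f\<close> by \<open>1\<close> on the least set containing \<open>y\<close> where this keeps \<open>f\<close> Lipschitz. Apart from \<open>y\<close>, all
  neighbours of \<open>x\<close> in this set are also neighbours of \<open>y\<close>.\<close>

lemma potentials_lower:
  assumes xy: "E x y" and deg: "vertex_degree E y \<le> vertex_degree E x"
    and f: "f \<in> potentials E x y" "f x = f y"
  obtains g where "g \<in> potentials E x y" "g x - g y = 1"
    "mean_gap E x y f - 1 / vertex_degree E x \<le> mean_gap E x y g"
proof -
  let ?X = "edge_nbhd E x y" and ?d = "walk_dist E"
  have yx: "E y x" using xy adj_sym by blast
  have X: "x \<in> ?X" "y \<in> ?X" "{z. E x z} \<subseteq> ?X" "{z. E y z} \<subseteq> ?X"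
    using xy yx by (auto simp: edge_nbhd_def)
  have lip: "f u - f v \<le> int (?d u v)" if "u \<in> ?X" "v \<in> ?X" for u v
    using f(1) that by (simp add: potentials_def int_lipschitz_def)
  define S where "S = {w \<in> ?X. f w - f y = int (?d w y)}"
  define g where "g = (\<lambda>u. f u - of_bool (u \<in> S))"
  have "y \<in> S" using X by (simp add: S_def)
  moreover have "x \<notin> S" using f(2) walk_dist_adj[OF xy] by (simp add: S_def)
  ultimately have gxy: "g x - g y = 1" using f(2) by (simp add: g_def)
  have "g u - g v \<le> int (?d u v)" if uv: "u \<in> ?X" "v \<in> ?X" for u v
  proof (cases "u \<notin> S \<and> v \<in> S")
    case True
    \<comment> \<open>If \<open>u\<close> were tight against a point \<open>v\<close> of
      \<open>S\<close>, the triangle inequality would make it tight against \<open>y\<close>,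
      putting it in \<open>S\<close>.\<close>
    have "f u - f v \<noteq> int (?d u v)"
    proof
      assume "f u - f v = int (?d u v)"
      moreover have "?d u y \<le> ?d u v + ?d v y"
        by (intro walk_dist_triangle edge_nbhd_connected[OF xy] uv X)
      ultimately have "f u - f y = int (?d u y)" using True lip[OF uv(1) X(2)] by (simp add: S_def)
      thus False using True uv by (simp add: S_def)
    qed
    thus ?thesis using lip[OF uv] True by (simp add: g_def)
  qed (use lip[OF uv] in \<open>auto simp: g_def\<close>)
  hence g: "g \<in> potentials E x y" by (simp add: potentials_def int_lipschitz_def)
  define K where "K = S \<inter> {z. E x z} \<inter> {z. E y z}"
  have "S \<inter> {z. E x z} \<subseteq> insert y K"
  proof
    fix w assume w: "w \<in> S \<inter> {z. E x z}"
    hence wX: "w \<in> ?X" and wx: "E w x" using X adj_sym by auto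
    \<comment> \<open>Tightness against \<open>y\<close> and \<open>f x = f y\<close> make this
      distance equal to \<open>f w - f x\<close>, which is at most the distance \<open>1\<close>
      from \<open>w\<close> to \<open>x\<close>.\<close>
    have "?d w y \<le> 1" using w f(2) lip[OF wX X(1)] walk_dist_adj[OF wx] by (auto simp: S_def)
    moreover have "E\<^sup>*\<^sup>* w y" using edge_nbhd_connected[OF xy wX X(2)] .
    ultimately have "w = y \<or> E w y" using walk_dist_eq_0D[of E w y] walk_dist_eq_1D[of E w y] by linarith
    thus "w \<in> insert y K" using w adj_sym by (auto simp: K_def)
  qed
  hence "card (S \<inter> {z. E x z}) \<le> card (insert y K)"
    by (intro card_mono) (auto simp: K_def finite_nbrs)
  also have "\<dots> \<le> card K + 1" by (simp add: card_insert_le_m1)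
  finally have c1: "card (S \<inter> {z. E x z}) \<le> card K + 1" .
  have c2: "card K \<le> card (S \<inter> {z. E y z})"
    by (intro card_mono) (auto simp: K_def finite_nbrs)
  have dx: "0 < real (vertex_degree E x)" and dy: "0 < real (vertex_degree E y)"
    using vertex_degree_pos[OF xy] vertex_degree_pos[OF yx] by auto
  \<comment> \<open>The mean at \<open>x\<close> drops by at most
    \<open>(card K + 1) / vertex_degree E x\<close>, while the mean at \<open>y\<close> drops by at
    least \<open>card K / vertex_degree E y\<close>. By the degree assumption only the contribution
    of \<open>y\<close> itself can remain.\<close>
  have "real (card (S \<inter> {z. E x z})) / vertex_degree E x \<le> (real (card K) + 1) / vertex_degree E x"
    using c1 dx by (intro divide_right_mono) auto
  also have "\<dots> = card K / vertex_degree E x + 1 / vertex_degree E x" by (simp add: add_divide_distrib)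
  also have "card K / vertex_degree E x \<le> real (card K) / vertex_degree E y"
    using deg dx dy by (intro divide_left_mono) auto
  also have "\<dots> \<le> real (card (S \<inter> {z. E y z})) / vertex_degree E y"
    using c2 dy by (intro divide_right_mono) auto
  finally have "mean_gap E x y f - 1 / vertex_degree E x \<le> mean_gap E x y g"
    by (simp add: mean_gap_def g_def nbr_mean_diff_indicator)
  thus ?thesis using that[OF g gxy] by blast
qed

text \<open>If \<open>y\<close> has the larger degree, the lowering is applied to \<open>-f\<close>
  with the endpoints exchanged, and the result is negated back.\<close>

lemma potentials_separate:
  assumes xy: "E x y" and f: "f \<in> potentials E x y" "f x = f y"
  obtains g where "g \<in> potentials E x y" "g x - g y = 1"
    "mean_gap E x y f - 1 / max (vertex_degree E x) (vertex_degree E y) \<le> mean_gap E x y g"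
proof (cases "vertex_degree E y \<le> vertex_degree E x")
  case True
  from potentials_lower[OF xy True f] that True show ?thesis by (auto simp: max_def)
next
  case False
  have yx: "E y x" using xy adj_sym by blast
  obtain g where g: "g \<in> potentials E y x" "g y - g x = 1"
    "mean_gap E y x (\<lambda>u. - f u) - 1 / vertex_degree E y \<le> mean_gap E y x g"
    using False f by (rule_tac potentials_lower[OF yx, of "\<lambda>u. - f u"])
      (auto simp: potentials_commute[of E y x] intro: uminus_potentials)
  show ?thesis
    by (rule that[of "\<lambda>u. - g u"]) (use g False in
      \<open>auto simp: potentials_commute[of E y x] mean_gap_uminus_commute max_def intro: uminus_potentials\<close>)
qed

section \<open>Common denominator and finiteness of the mean gaps\<close>

lemma mean_gap_integral:
  assumes xy: "E x y"
  obtains k :: int where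
    "lcm (vertex_degree E x) (vertex_degree E y) * mean_gap E x y f = k"
proof -
  let ?L = "lcm (vertex_degree E x) (vertex_degree E y)"
  obtain m n where m: "?L = vertex_degree E x * m" and n: "?L = vertex_degree E y * n"
    by (meson dvd_def dvd_lcm1 dvd_lcm2)
  have yx: "E y x" using xy adj_sym by blast
  have "real ?L * nbr_mean E f x = m * (\<Sum>z | E x z. f z)"
    unfolding m nbr_mean_def using vertex_degree_pos[OF xy] by simp
  moreover have "real ?L * nbr_mean E f y = n * (\<Sum>z | E y z. f z)"
    unfolding n nbr_mean_def using vertex_degree_pos[OF yx] by simp
  ultimately have "real ?L * mean_gap E x y f =
      of_int (int m * (\<Sum>z | E x z. f z) - int n * (\<Sum>z | E y z. f z))"
    by (simp add: mean_gap_def right_diff_distrib)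
  thus ?thesis by (rule that)
qed

text \<open>The potentials themselves are infinitely many, since constants can be added; but their
  gaps are bounded multiples of \<open>1 / lcm\<close>. This makes maxima over classes of potentials
  legitimate.\<close>

lemma finite_mean_gaps:
  assumes xy: "E x y"
  shows "finite (mean_gap E x y ` potentials E x y)"
proof -
  let ?L = "lcm (vertex_degree E x) (vertex_degree E y)"
  have yx: "E y x" using xy adj_sym by blast
  have L: "0 < real ?L"
    using vertex_degree_pos[OF xy] vertex_degree_pos[OF yx] by (simp add: lcm_pos_nat)
  \<comment> \<open>At \<open>p = 0\<close> the dual functional is the gap itself, so the
    Wasserstein distance there is an upper bound; negating potentials turns it into a lower
    one.\<close>
  obtain B where B: "\<And>g. g \<in> potentials E x y \<Longrightarrow> mean_gap E x y g \<le> B"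
    using wasserstein_walk_measure_eq[OF xy, of 0] by auto
  define M where "M = \<lceil>?L * B\<rceil>"
  have "mean_gap E x y f \<in> (\<lambda>k. of_int k / ?L) ` {-M..M}" if f: "f \<in> potentials E x y" for f
  proof -
    obtain k :: int where k: "?L * mean_gap E x y f = k" using mean_gap_integral[OF xy] .
    have "mean_gap E x y f \<le> B" "- mean_gap E x y f \<le> B"
      using B[OF f] B[OF uminus_potentials[OF f]] unfolding mean_gap_uminus_commute
      by (auto simp: mean_gap_def)
    from this[THEN mult_left_mono, OF less_imp_le[OF L]]
    have "?L * mean_gap E x y f \<le> ?L * B" "?L * (- mean_gap E x y f) \<le> ?L * B" .
    hence "of_int k \<le> ?L * B" "of_int (- k) \<le> ?L * B" unfolding k[symmetric] of_int_minus by simp_all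
    hence "of_int k \<le> real_of_int M" "of_int (- k) \<le> real_of_int M"
      unfolding M_def by (meson le_of_int_ceiling order_trans)+
    hence "k \<in> {-M..M}" unfolding of_int_le_iff by simp
    moreover have "mean_gap E x y f = of_int k / ?L"
      using L by (simp only: k[symmetric] nonzero_mult_div_cancel_left[OF less_imp_neq[OF L, symmetric]])
    ultimately show ?thesis by blast
  qed
  hence "mean_gap E x y ` potentials E x y \<subseteq> (\<lambda>k. of_int k / ?L) ` {-M..M}" by blast
  thus ?thesis by (rule finite_subset) simp
qed

end

subsection \<open>Piecewise linearity\<close>

lemma affine_fun_on_subset: "affine_fun_on T f \<Longrightarrow> S \<subseteq> T \<Longrightarrow> affine_fun_on S f"
  unfolding affine_fun_on_def by blast

lemma piecewise_linear_on_mono: "piecewise_linear_on k a b f \<Longrightarrow> k \<le> l \<Longrightarrow> piecewise_linear_on l a b f"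
  unfolding piecewise_linear_on_def using le_trans by blast

text \<open>The definition demands strictly increasing break points. Allowing \<open>b = c\<close>
  here, where the degenerate piece is dropped, lets break points coincide in the
  applications.\<close>

lemma piecewise_linear_on_snoc:
  assumes "piecewise_linear_on k a b f" "b \<le> c" "affine_fun_on {b..c} f"
  shows "piecewise_linear_on (Suc k) a c f"
proof (cases "b = c")
  case False
  obtain n t where t: "n \<le> k" "t 0 = a" "t n = b"
    "\<forall>i<n. t i < t (Suc i) \<and> affine_fun_on {t i..t (Suc i)} f"
    using assms(1) unfolding piecewise_linear_on_def by blast
  show ?thesis unfolding piecewise_linear_on_def
    by (rule exI[of _ "Suc n"], rule exI[of _ "t(Suc n := c)"])
      (use t assms False in \<open>auto simp: less_Suc_eq\<close>)
qed (use assms piecewise_linear_on_mono[of k] in auto)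

lemma piecewise_linear_on_empty: "piecewise_linear_on 0 a a f"
  unfolding piecewise_linear_on_def by (auto intro: exI[of _ "\<lambda>_. a"])

text \<open>The maximum of the three lines \<open>p * j + (1 - p) * c\<^sub>j\<close> with \<open>j = 1, 0, -1\<close>. The lines \<open>j\<close> and
  \<open>j - 1\<close> cross where \<open>p / (1 - p) = c\<^bsub>j - 1\<^esub> - c\<^sub>j\<close>, and discrete concavity of \<open>c\<close>
  makes these two crossings come in the right order.\<close>
lemma max_three_lines_segments:
  fixes c1 c0 cm :: real
  assumes W: "\<And>p. p \<in> {0..1} \<Longrightarrow>
      W p = max (p + (1 - p) * c1) (max ((1 - p) * c0) (- p + (1 - p) * cm))"
    and concave: "c1 + cm \<le> 2 * c0"
    and L: "0 < L" "c0 - c1 \<le> 0 \<or> 1 / L \<le> c0 - c1" "cm - c0 \<le> 0 \<or> 1 / L \<le> cm - c0"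
    and D: "0 < D" "c0 - 1 / D \<le> c1"
  obtains a b where "0 \<le> a" "a \<le> b" "b \<le> 1 / (D + 1)"
    "a = 0 \<or> 1 / (L + 1) \<le> a" "b = 0 \<or> 1 / (L + 1) \<le> b"
    "affine_fun_on {0..a} (\<lambda>p. 1 - W p)" "affine_fun_on {a..b} (\<lambda>p. 1 - W p)"
    "affine_fun_on {b..1} (\<lambda>p. 1 - W p)"
proof -
  \<comment> \<open>The solution of \<open>p / (1 - p) = \<delta>\<close>, with a crossing at
    negative \<delta> moved to the left endpoint \<open>0\<close>.\<close>
  define r where "r \<delta> = max 0 \<delta> / (1 + max 0 \<delta>)" for \<delta> :: real
  have r_eq: "p \<le> r \<delta> \<longleftrightarrow> p \<le> (1 - p) * max 0 \<delta>" for p \<delta>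
    by (simp add: r_def pos_le_divide_eq algebra_simps)
  have r_eq': "r \<delta> \<le> p \<longleftrightarrow> (1 - p) * max 0 \<delta> \<le> p" for p \<delta>
    by (simp add: r_def pos_divide_le_eq algebra_simps)
  have r0: "0 \<le> r \<delta>" and r1: "r \<delta> < 1" for \<delta> by (auto simp: r_def pos_divide_less_eq)
  have r_mono: "r \<delta> \<le> r \<delta>'" if "\<delta> \<le> \<delta>'" for \<delta> \<delta>'
  proof -
    have "(1 - r \<delta>) * max 0 \<delta> \<le> (1 - r \<delta>) * max 0 \<delta>'"
      using that r1[of \<delta>] by (intro mult_left_mono) auto
    thus ?thesis using r_eq[of "r \<delta>" \<delta>] r_eq[of "r \<delta>" \<delta>'] by linarith
  qed
  have r_inverse: "r (1 / M) = 1 / (M + 1)" if "0 < M" for M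
    using that by (simp add: r_def field_simps)
  let ?a = "r (cm - c0)" and ?b = "r (c0 - c1)"
  have above: "(1 - p) * \<delta> \<le> p" if "r \<delta> \<le> p" "p \<le> 1" for p \<delta>
    using that mult_left_mono[of \<delta> "max 0 \<delta>" "1 - p"] unfolding r_eq' by linarith
  \<comment> \<open>Positivity of \<open>r \<delta>\<close> excludes a clipped crossing: for
    negative \<delta> the inequality fails at \<open>p = 0\<close>.\<close>
  have below: "p \<le> (1 - p) * \<delta>" if "p \<le> r \<delta>" "0 \<le> p" "0 < r \<delta>" for p \<delta>
  proof -
    have "0 < \<delta>"
    proof (rule ccontr)
      assume "\<not> 0 < \<delta>"
      hence "r \<delta> = 0" by (simp add: r_def)
      thus False using that(3) by simp
    qed
    thus ?thesis using that(1) unfolding r_eq by (simp add: max_def)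
  qed
  have ab: "?a \<le> ?b" using concave by (intro r_mono) linarith
  \<comment> \<open>As \<open>r\<close> is monotone and sends \<open>1 / L\<close> to
    \<open>1 / (L + 1)\<close>, a gap between coefficients becomes a gap between \<open>0\<close>
    and the first positive break point.\<close>
  have quant: "r \<delta> = 0 \<or> 1 / (L + 1) \<le> r \<delta>" if "\<delta> \<le> 0 \<or> 1 / L \<le> \<delta>" for \<delta>
    using that r_mono[of "1 / L" \<delta>] r_inverse[OF L(1)] by (auto simp: r_def)
  have bD: "?b \<le> 1 / (D + 1)" using r_mono[of "c0 - c1" "1 / D"] r_inverse[OF D(1)] D(2) by simp
  have A1: "affine_fun_on {?b..1} (\<lambda>p. 1 - W p)" unfolding affine_fun_on_def
  proof (intro exI ballI)
    fix p assume p: "p \<in> {?b..1}"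
    have "(1 - p) * (c0 - c1) \<le> p" "(1 - p) * (cm - c0) \<le> p"
      using p ab by (auto intro!: above)
    hence "W p = p + (1 - p) * c1"
      using p r0[of "c0 - c1"] by (simp add: W right_diff_distrib)
    thus "1 - W p = (c1 - 1) * p + (1 - c1)" by (simp add: algebra_simps)
  qed
  have A2: "affine_fun_on {?a..?b} (\<lambda>p. 1 - W p)"
  proof (cases "?b = 0")
    case True
    hence "{?a..?b} \<subseteq> {?b..1}" using r0[of "cm - c0"] by auto
    thus ?thesis by (rule affine_fun_on_subset[OF A1])
  next
    case False
    show ?thesis unfolding affine_fun_on_def
    proof (intro exI ballI)
      fix p assume p: "p \<in> {?a..?b}"
      have p01: "0 \<le> p" "p \<le> 1" using p r0[of "cm - c0"] r1[of "c0 - c1"] by auto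
      have "p \<le> (1 - p) * (c0 - c1)" "(1 - p) * (cm - c0) \<le> p"
        using p p01 False r0[of "c0 - c1"] by (auto intro!: above below)
      hence "W p = (1 - p) * c0" using p01 by (simp add: W right_diff_distrib)
      thus "1 - W p = c0 * p + (1 - c0)" by (simp add: algebra_simps)
    qed
  qed
  have A3: "affine_fun_on {0..?a} (\<lambda>p. 1 - W p)"
  proof (cases "?a = 0")
    case True
    hence "{0..?a} \<subseteq> {?a..?b}" using r0[of "c0 - c1"] by auto
    thus ?thesis by (rule affine_fun_on_subset[OF A2])
  next
    case False
    show ?thesis unfolding affine_fun_on_def
    proof (intro exI ballI)
      fix p assume p: "p \<in> {0..?a}"
      have p01: "0 \<le> p" "p \<le> 1" using p r1[of "cm - c0"] by auto
      have "p \<le> (1 - p) * (c0 - c1)" "p \<le> (1 - p) * (cm - c0)"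
        using p p01 False ab r0[of "cm - c0"] by (auto intro!: below)
      hence "W p = - p + (1 - p) * cm" using p01 by (simp add: W right_diff_distrib)
      thus "1 - W p = (1 + cm) * p + (1 - cm)" by (simp add: algebra_simps)
    qed
  qed
  show ?thesis by (rule that[OF r0 ab bD quant[OF L(3)] quant[OF L(2)] A3 A2 A1])
qed

text \<open>The coefficients are the largest mean gaps among potentials whose drop from
  \<open>x\<close> to \<open>y\<close> is \<open>1\<close>, \<open>0\<close> or \<open>-1\<close>.
  For a fixed drop only the largest gap matters, because its factor \<open>1 - p\<close> is
  nonnegative.\<close>

lemma (in locally_finite_graph) wasserstein_walk_measure_max_three_lines:
  assumes xy: "E x y"
  defines "D \<equiv> max (vertex_degree E x) (vertex_degree E y)"
    and "L \<equiv> lcm (vertex_degree E x) (vertex_degree E y)"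
  obtains c1 c0 cm where
    "\<And>p. p \<in> {0..1} \<Longrightarrow> enn2real (wasserstein V E (walk_measure E p x) (walk_measure E p y)) =
      max (p + (1 - p) * c1) (max ((1 - p) * c0) (- p + (1 - p) * cm))"
    "c1 + cm \<le> 2 * c0" "c0 - 1 / D \<le> c1"
    "c0 - c1 \<le> 0 \<or> 1 / L \<le> c0 - c1" "cm - c0 \<le> 0 \<or> 1 / L \<le> cm - c0"
proof -
  let ?W = "\<lambda>p. enn2real (wasserstein V E (walk_measure E p x) (walk_measure E p y))"
  define F where "F j = {f \<in> potentials E x y. f x - f y = j}" for j
  define c where "c j = Max (mean_gap E x y ` F j)" for j
  have fin: "finite (mean_gap E x y ` F j)" for j
    by (rule finite_subset[OF _ finite_mean_gaps[OF xy]]) (auto simp: F_def)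
  \<comment> \<open>All three classes must be inhabited for \<open>Max\<close> to be meaningful: the
    zero potential, a separation of it, and the negative of that.\<close>
  have "(\<lambda>_. 0) \<in> potentials E x y" by (simp add: potentials_def int_lipschitz_def)
  moreover from this obtain g where g: "g \<in> potentials E x y" "g x - g y = 1"
    by (rule potentials_separate[OF xy]) simp
  moreover have "(\<lambda>u. - g u) \<in> potentials E x y" using g uminus_potentials by blast
  ultimately have "(\<lambda>_. 0) \<in> F 0" "g \<in> F 1" "(\<lambda>u. - g u) \<in> F (- 1)"
    by (auto simp: F_def)
  hence ne: "mean_gap E x y ` F j \<noteq> {}" if "j \<in> {-1, 0, 1}" for j using that by auto
  have le: "mean_gap E x y f \<le> c j" if "f \<in> F j" for f j
    unfolding c_def using that by (intro Max_ge fin) auto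
  have att: "\<exists>f\<in>F j. mean_gap E x y f = c j" if "j \<in> {-1, 0, 1}" for j
    using Max_in[OF fin ne[OF that]] unfolding c_def by auto
  obtain f1 where f1: "f1 \<in> F 1" "mean_gap E x y f1 = c 1" using att[of 1] by auto
  obtain f0 where f0: "f0 \<in> F 0" "mean_gap E x y f0 = c 0" using att[of 0] by auto
  obtain fm where fm: "fm \<in> F (-1)" "mean_gap E x y fm = c (-1)" using att[of "-1"] by auto
  have W: "?W p = max (p + (1 - p) * c 1) (max ((1 - p) * c 0) (- p + (1 - p) * c (-1)))"
    if p: "p \<in> {0..1}" for p
  proof -
    obtain h where h: "h \<in> potentials E x y" "?W p = p * (h x - h y) + (1 - p) * mean_gap E x y h"
      and bound: "\<And>g. g \<in> potentials E x y \<Longrightarrow> p * (g x - g y) + (1 - p) * mean_gap E x y g \<le> ?W p"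
      by (rule wasserstein_walk_measure_eq[OF xy p]) (rule that, assumption, assumption, blast)
    define j where "j = h x - h y"
    have "?W p \<le> p * j + (1 - p) * c j"
      unfolding h(2) j_def using le[of h "h x - h y"] h(1) p
      by (intro add_mono mult_left_mono) (auto simp: F_def)
    moreover have "j \<in> {-1, 0, 1}" unfolding j_def by (rule edge_potential_range[OF xy h(1)])
    ultimately have "?W p \<le> max (p + (1 - p) * c 1) (max ((1 - p) * c 0) (- p + (1 - p) * c (-1)))"
      by auto
    moreover have "p * j + (1 - p) * mean_gap E x y g \<le> ?W p" if "g \<in> F j" for g j
      using bound[of g] that by (auto simp: F_def)
    from this[OF f1(1)] this[OF f0(1)] this[OF fm(1)]
    have "max (p + (1 - p) * c 1) (max ((1 - p) * c 0) (- p + (1 - p) * c (-1))) \<le> ?W p"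
      unfolding f1 f0 fm by simp
    ultimately show ?thesis by (rule antisym)
  qed
  have concave: "c 1 + c (-1) \<le> 2 * c 0"
  proof -
    have "f1 \<in> potentials E x y" "f1 x - f1 y = 1" "fm \<in> potentials E x y" "fm x - fm y = -1"
      using f1 fm by (simp_all add: F_def)
    then obtain h k where hk: "h \<in> potentials E x y" "h x = h y" "k \<in> potentials E x y" "k x = k y"
      "mean_gap E x y h + mean_gap E x y k = mean_gap E x y f1 + mean_gap E x y fm"
      by (rule potentials_midpoint[OF xy])
    hence "h \<in> F 0" "k \<in> F 0" "mean_gap E x y h + mean_gap E x y k = c 1 + c (-1)"
      using f1 fm by (simp_all add: F_def)
    thus ?thesis using le[of h 0] le[of k 0] by linarith
  qed
  have "f0 \<in> potentials E x y" "f0 x = f0 y" using f0 by (simp_all add: F_def)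
  then obtain h where "h \<in> potentials E x y" "h x - h y = 1"
    "mean_gap E x y f0 - 1 / max (vertex_degree E x) (vertex_degree E y) \<le> mean_gap E x y h"
    by (rule potentials_separate[OF xy])
  hence "h \<in> F 1" "c 0 - 1 / D \<le> mean_gap E x y h" using f0 by (simp_all add: F_def D_def)
  hence step: "c 0 - 1 / D \<le> c 1" using le[of h 1] by linarith
  have quant: "c i - c j \<le> 0 \<or> 1 / L \<le> c i - c j"
    if ij: "i \<in> {-1, 0, 1}" "j \<in> {-1, 0, 1}" for i j
  proof -
    have "0 < L"
      using vertex_degree_pos[OF xy] vertex_degree_pos[OF adj_sym[OF xy]] by (simp add: L_def lcm_pos_nat)
    obtain f where f: "mean_gap E x y f = c i" using att[OF ij(1)] by blast
    obtain g where g: "mean_gap E x y g = c j" using att[OF ij(2)] by blast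
    obtain a :: int where a: "L * mean_gap E x y f = a"
      unfolding L_def by (rule mean_gap_integral[OF xy])
    obtain b :: int where b: "L * mean_gap E x y g = b"
      unfolding L_def by (rule mean_gap_integral[OF xy])
    have "L * c i = a" "L * c j = b" using a b unfolding f g by simp_all
    hence ab: "L * (c i - c j) = of_int (a - b)"
      by (simp add: right_diff_distrib)
    show ?thesis
    proof (cases "a \<le> b")
      case True
      hence "L * (c i - c j) \<le> 0" unfolding ab by simp
      thus ?thesis using \<open>0 < L\<close> by (simp add: mult_le_0_iff)
    next
      case False
      hence "1 \<le> L * (c i - c j)" unfolding ab by simp
      thus ?thesis using \<open>0 < L\<close> by (simp add: pos_divide_le_eq mult.commute)
    qed
  qed
  show ?thesis by (rule that[OF W concave step quant quant]) auto
qed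

lemma convex_on_max:
  assumes "convex_on S f" "convex_on S g"
  shows "convex_on S (\<lambda>x. max (f x) (g x))"
  unfolding convex_on_def
proof (intro conjI ballI allI impI)
  fix x y u v assume uv: "x \<in> S" "y \<in> S" "0 \<le> u" "0 \<le> v" "u + v = (1::real)"
  have "u * f x + v * f y \<le> u * max (f x) (g x) + v * max (f y) (g y)"
    "u * g x + v * g y \<le> u * max (f x) (g x) + v * max (f y) (g y)"
    using uv by (auto intro!: add_mono mult_left_mono)
  moreover have "f (u *\<^sub>R x + v *\<^sub>R y) \<le> u * f x + v * f y"
    "g (u *\<^sub>R x + v *\<^sub>R y) \<le> u * g x + v * g y"
    using assms uv by (auto simp: convex_on_def)
  ultimately show "max (f (u *\<^sub>R x + v *\<^sub>R y)) (g (u *\<^sub>R x + v *\<^sub>R y)) \<le>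
      u * max (f x) (g x) + v * max (f y) (g y)" by linarith
qed (use assms convex_on_imp_convex in blast)

lemma convex_on_max_three_lines:
  fixes c1 c0 cm :: real
  shows "convex_on {0..1} (\<lambda>p. max (p + (1 - p) * c1) (max ((1 - p) * c0) (- p + (1 - p) * cm)))"
proof -
  have affine: "convex_on {0..1} (\<lambda>p. p * j + (1 - p) * c)" for j c :: real
    by (rule convex_onI) (auto simp: algebra_simps)
  show ?thesis
    using affine[of 1 c1] affine[of 0 c0] affine[of "-1" cm] by (simp add: convex_on_max)
qed

theorem theorem1p1:
  fixes V :: "'a set" and E :: "'a \<Rightarrow> 'a \<Rightarrow> bool" and x y :: 'a
  assumes "locally_finite_graph V E"
    and "x \<in> V" and "y \<in> V" and "E x y"
  shows "concave_on {0..1} (\<lambda>p. ollivier_curvature V E p x y)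
    \<and> piecewise_linear_on 3 0 1 (\<lambda>p. ollivier_curvature V E p x y)
    \<and> affine_fun_on {0..1 / (real (lcm (vertex_degree E x) (vertex_degree E y)) + 1)}
        (\<lambda>p. ollivier_curvature V E p x y)
    \<and> affine_fun_on {1 / (real (max (vertex_degree E x) (vertex_degree E y)) + 1)..1}
        (\<lambda>p. ollivier_curvature V E p x y)
    \<and> (vertex_degree E x = vertex_degree E y \<longrightarrow>
        piecewise_linear_on 2 0 1 (\<lambda>p. ollivier_curvature V E p x y))"
proof -
  interpret locally_finite_graph V E by (rule assms(1))
  have yx: "E y x" using assms(4) adj_sym by blast
  let ?\<kappa> = "\<lambda>p. ollivier_curvature V E p x y"
  let ?W = "\<lambda>p. enn2real (wasserstein V E (walk_measure E p x) (walk_measure E p y))"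
  define L where "L = real (lcm (vertex_degree E x) (vertex_degree E y))"
  define D where "D = real (max (vertex_degree E x) (vertex_degree E y))"
  have pos: "0 < L" "0 < D"
    using vertex_degree_pos[OF assms(4)] vertex_degree_pos[OF yx] by (auto simp: L_def D_def lcm_pos_nat)
  obtain c1 c0 cm where W: "\<And>p. p \<in> {0..1} \<Longrightarrow>
      ?W p = max (p + (1 - p) * c1) (max ((1 - p) * c0) (- p + (1 - p) * cm))"
    and c: "c1 + cm \<le> 2 * c0" "c0 - 1 / D \<le> c1"
    "c0 - c1 \<le> 0 \<or> 1 / L \<le> c0 - c1" "cm - c0 \<le> 0 \<or> 1 / L \<le> cm - c0"
    using wasserstein_walk_measure_max_three_lines[OF assms(4)] unfolding L_def D_def by blast
  have concave: "concave_on {0..1} ?\<kappa>" unfolding concave_on_iff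
  proof (intro conjI ballI allI impI)
    fix p q u v :: real
    assume pq: "p \<in> {0..1}" "q \<in> {0..1}" and uv: "0 \<le> u" "0 \<le> v" "u + v = 1"
    have "u *\<^sub>R p + v *\<^sub>R q \<in> {0..1}" using pq uv by (intro convexD[OF convex_closed_interval]) auto
    hence "?W (u *\<^sub>R p + v *\<^sub>R q) \<le> u * ?W p + v * ?W q"
      using convex_on_max_three_lines[of c1 c0 cm] pq uv unfolding convex_on_def by (simp add: W)
    moreover have "u * ?\<kappa> p + v * ?\<kappa> q = 1 - (u * ?W p + v * ?W q)"
      using uv by (simp add: ollivier_curvature_def right_diff_distrib)
    ultimately show "u * ?\<kappa> p + v * ?\<kappa> q \<le> ?\<kappa> (u *\<^sub>R p + v *\<^sub>R q)"
      by (simp add: ollivier_curvature_def)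
  qed auto
  obtain a b where ab: "0 \<le> a" "a \<le> b" "b \<le> 1 / (D + 1)"
    and quant: "a = 0 \<or> 1 / (L + 1) \<le> a" "b = 0 \<or> 1 / (L + 1) \<le> b"
    and affine: "affine_fun_on {0..a} ?\<kappa>" "affine_fun_on {a..b} ?\<kappa>" "affine_fun_on {b..1} ?\<kappa>"
    using max_three_lines_segments[OF W c(1) pos(1) c(3,4) pos(2) c(2)]
    unfolding ollivier_curvature_def by blast
  have D1: "1 / (D + 1) \<le> 1" and L1: "1 / (L + 1) \<le> 1" using pos by (auto simp: field_simps)
  have "piecewise_linear_on (Suc (Suc (Suc 0))) 0 1 ?\<kappa>"
    by (intro piecewise_linear_on_snoc[OF piecewise_linear_on_snoc[OF
        piecewise_linear_on_snoc[OF piecewise_linear_on_empty]]])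
      (use ab D1 affine in auto)
  hence pl3: "piecewise_linear_on 3 0 1 ?\<kappa>" by (simp add: numeral_3_eq_3)
  have low: "affine_fun_on {0..1 / (L + 1)} ?\<kappa>"
  proof -
    \<comment> \<open>Neither break point lies strictly between \<open>0\<close> and
      \<open>1 / (L + 1)\<close>, so the interval fits into the first nondegenerate piece.\<close>
    consider "1 / (L + 1) \<le> a" | "a = 0" "1 / (L + 1) \<le> b" | "b = 0" using quant by blast
    thus ?thesis
    proof cases
      case 1 thus ?thesis by (intro affine_fun_on_subset[OF affine(1)]) auto
    next
      case 2 thus ?thesis by (intro affine_fun_on_subset[OF affine(2)]) auto
    next
      case 3 thus ?thesis using L1 by (intro affine_fun_on_subset[OF affine(3)]) auto
    qed
  qed
  have high: "affine_fun_on {1 / (D + 1)..1} ?\<kappa>"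
    using ab by (intro affine_fun_on_subset[OF affine(3)]) auto
  have "piecewise_linear_on 2 0 1 ?\<kappa>" if "vertex_degree E x = vertex_degree E y"
  proof -
    \<comment> \<open>For equal degrees both the lcm and the maximum are the common degree, so the
      two linear intervals meet and cover \<open>[0, 1]\<close>.\<close>
    have "L = D" using that by (simp add: L_def D_def)
    hence "piecewise_linear_on (Suc (Suc 0)) 0 1 ?\<kappa>"
      by (intro piecewise_linear_on_snoc[OF piecewise_linear_on_snoc[OF piecewise_linear_on_empty]])
        (use low high D1 pos in auto)
    thus ?thesis by (simp add: numeral_2_eq_2)
  qed
  with concave pl3 low high show ?thesis by (simp add: L_def D_def)
qed

end
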